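(* Let $\Omega\subset\mathbb{R}^N$ be a nonempty open bounded connected set with $\mathcal{L}^N(\Omega)=1$, $X=\overline{\Omega}$, $Y\subset\mathbb{R}^N$ open with $\mathcal{L}^N(Y)=1$, $\mu=\mathcal{L}^N\llcorner\Omega$, $\nu=\mathcal{L}^N\llcorner Y$, $H,K:X\to(0,+\infty)$ in $L^1(X,\mu)$ and $\mathcal{A}$ a family of balls covering $X$. Let $u\in\mathrm{Refo}(\mu;\nu)^{H,K}$ be incompressible, i.e. $|Ju(x)|=1$ for a.e. $x\in\Omega$, where $Ju=\det\nabla u$. Then $u|_\Omega$ is globally invertible (injective).
   Context: For $u:X\to Y$, $x_0\in X$: $e_u(x_0)=\limsup_{x\to x_0,\,x\ne x_0}\frac{|u(x)-u(x_0)|}{|x-x_0|}$, $c_u(x_0)=\limsup_{x\to x_0,\,x\ne x_0}\frac{|x-x_0|}{|u(x)-u(x_0)|}$ (quotient $+\infty$ if $u(x)=u(x_0)$). $\mathrm{Refo}(\mu;\nu)^{H,K}$ is the set of maps $u:X\to Y$ with $u_\#\mu=\nu$ (i.e. $\mu(u^{-1}(A))=\nu(A)$ for Borel $A$) such that for every $x\in X$ there is $B(x,r)\in\mathcal{A}$ with $c_u(y)\le H(x)$, $e_u(y)\le K(x)$ for all $y\in\overline{B}(x,r)\cap\Omega$. (Such $u$ are locally Lipschitz on $\Omega$, hence a.e. differentiable.) *)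

theory Defs
  imports "HOL-Analysis.Analysis"
begin

definition upper_dil :: "('a::metric_space) set \<Rightarrow> ('a \<Rightarrow> 'b::metric_space) \<Rightarrow> 'a \<Rightarrow> ereal" where
  "upper_dil X u x0 = Limsup (at x0 within X) (\<lambda>x. ereal (dist (u x) (u x0) / dist x x0))"

definition co_dil :: "('a::metric_space) set \<Rightarrow> ('a \<Rightarrow> 'b::metric_space) \<Rightarrow> 'a \<Rightarrow> ereal" where
  "co_dil X u x0 = Limsup (at x0 within X)
     (\<lambda>x. if u x = u x0 then \<infinity> else ereal (dist x x0 / dist (u x) (u x0)))"

text \<open>Refo(mu; nu)^{H,K}, with mu = Lebesgue restricted to Omega, nu = Lebesgue restricted to Y,
  X = closure Omega, and a family \<A> of balls (as sets).\<close>
definition Refo ::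
  "(real^'n) set \<Rightarrow> (real^'n) set \<Rightarrow> (real^'n) set set \<Rightarrow> (real^'n \<Rightarrow> real) \<Rightarrow> (real^'n \<Rightarrow> real)
   \<Rightarrow> (real^'n \<Rightarrow> real^'n) set" where
  "Refo \<Omega> Y \<A> H K = {u. u ` closure \<Omega> \<subseteq> Y \<and>
      (\<forall>A \<in> sets borel. emeasure lebesgue (\<Omega> \<inter> u -` A) = emeasure lebesgue (Y \<inter> A)) \<and>
      (\<forall>x \<in> closure \<Omega>. \<exists>r>0. ball x r \<in> \<A> \<and>
         (\<forall>y \<in> cball x r \<inter> \<Omega>. co_dil (closure \<Omega>) u y \<le> ereal (H x) \<and>
                                 upper_dil (closure \<Omega>) u y \<le> ereal (K x)))}"

end

theory Submission
  imports Defs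
begin

text \<open>
  The bound on the upper dilation makes \<open>u\<close> locally Lipschitz, hence differentiable almost everywhere
  by Rademacher's theorem, and \<open>\<bar>Ju\<bar> = 1\<close> gives \<open>\<bar>u S\<bar> \<le> \<bar>S\<bar>\<close>. Since \<open>u\<close> is measure preserving, a set \<open>E\<close> all of
  whose points have two preimages would satisfy \<open>\<bar>E\<bar> = \<bar>u\<^sup>-\<^sup>1 E\<bar> \<ge> 2\<bar>E\<bar>\<close>, so almost every point of \<open>Y\<close> has at most
  one preimage.

  This almost everywhere injectivity makes \<open>u\<close> open. Let \<open>V\<close> be a small ball about \<open>u x0\<close>; the bound on
  the co-dilation isolates \<open>x0\<close> in its fibre, so \<open>V\<close> misses the image of a small sphere about \<open>x0\<close>. The
  image of the ball meets \<open>V\<close> in positive measure, hence some \<open>q \<in> V\<close> has exactly one preimage in the ball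
  and \<open>u\<close> has a nonsingular derivative there. So the degree about \<open>q\<close>, and therefore about every point of
  \<open>V\<close>, is nonzero, and \<open>V\<close> is covered. Two distinct points with the same value would thus make a whole
  ball of values doubly covered.
\<close>

section \<open>Degree of a map with one regular preimage\<close>

text \<open>The Jacobian is known only up to sign, and the sign may vary from point to point, so
  contributions of several preimages to a degree could cancel. A value with a single preimage in the
  ball rules this out, which is why almost everywhere injectivity has to precede openness. The
  integer degree is never formed: that it is nonzero is expressed by a map from the unit sphere to
  the complement of 0 not being homotopic to a constant. Points where \<open>u\<close> lacks a
  derivative of determinant \<plusminus>1 do no harm, since a locally Lipschitz map sends this null
  set to a null set of values. Measure preservation serves twice: it bounds the doubly covered
  values, and it makes the preimage of a null set of values null, so that the image of a ball cannot
  be negligible near \<open>u x0\<close>.\<close>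

lemma nested_cball_step:
  fixes x0 x1 :: "'a::real_normed_vector"
  assumes x1: "dist x0 x1 + \<rho> \<le> r" and \<rho>: "\<rho> > 0" and s: "0 \<le> s" "s \<le> 1" and \<theta>: "norm \<theta> = 1"
  defines "p \<equiv> (1 - s) *\<^sub>R (x1 + \<rho> *\<^sub>R \<theta>) + s *\<^sub>R (x0 + r *\<^sub>R \<theta>)"
  shows "p \<in> cball x0 r" "p \<noteq> x1"
proof -
  have "p - x0 = (1 - s) *\<^sub>R (x1 - x0) + ((1 - s) * \<rho> + s * r) *\<^sub>R \<theta>"
    by (simp add: p_def algebra_simps)
  then have "norm (p - x0) \<le> (1 - s) * dist x0 x1 + \<bar>(1 - s) * \<rho> + s * r\<bar>"
    using norm_triangle_ineq[of "(1 - s) *\<^sub>R (x1 - x0)" "((1 - s) * \<rho> + s * r) *\<^sub>R \<theta>"] s \<theta>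
    by (simp add: dist_norm norm_minus_commute)
  moreover have r: "r > 0" using x1 \<rho> by (smt (verit) zero_le_dist)
  then have "(1 - s) * \<rho> + s * r > 0"
    using s \<rho> by (cases "s = 0") (auto intro!: add_nonneg_pos)
  moreover have "(1 - s) * (dist x0 x1 + \<rho>) \<le> (1 - s) * r"
    using x1 s by (intro mult_left_mono) auto
  ultimately have "norm (p - x0) \<le> r"
    by (simp add: algebra_simps)
  then show "p \<in> cball x0 r"
    by (simp add: dist_norm norm_minus_commute)
  show "p \<noteq> x1"
  proof
    assume "p = x1"
    \<comment> \<open>Equality would make the displacement from \<open>x0\<close> to
      \<open>x1\<close>, scaled by \<open>s\<close>, a multiple of \<open>\<theta>\<close>;
      comparing lengths with \<open>s * (dist x0 x1 + \<rho>) \<le> s * r\<close> leaves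
      \<open>\<rho> \<le> 0\<close>.\<close>
    then have "s *\<^sub>R (x1 - x0) = ((1 - s) * \<rho> + s * r) *\<^sub>R \<theta>"
      by (simp add: p_def algebra_simps)
    then have "s * dist x0 x1 = (1 - s) * \<rho> + s * r"
      using s \<theta> \<open>(1 - s) * \<rho> + s * r > 0\<close>
      by (metis abs_of_nonneg abs_of_pos dist_commute dist_norm mult.right_neutral norm_scaleR)
    moreover have "s * (dist x0 x1 + \<rho>) \<le> s * r"
      using x1 s by (intro mult_left_mono) auto
    ultimately show False using \<rho> s by (simp add: algebra_simps)
  qed
qed

text \<open>A null-homotopy would extend \<open>L\<close> from the sphere to a map of the whole ball
  that avoids 0. Undoing \<open>L\<close> by its inverse \<open>M\<close> and normalising turns the
  extension into a retraction of the ball onto its sphere, contradicting the no-retraction theorem.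
  This stands in for the fact that an invertible linear map has degree \<plusminus>1.\<close>

lemma not_nullhomotopic_linear_sphere:
  fixes L :: "'a::euclidean_space \<Rightarrow> 'a"
  assumes "linear L" "inj L"
  shows "\<not> (\<exists>c. homotopic_with_canon (\<lambda>x. True) (sphere 0 1) (- {0}) L (\<lambda>x. c))"
proof
  assume "\<exists>c. homotopic_with_canon (\<lambda>x. True) (sphere 0 1) (- {0}) L (\<lambda>x. c)"
  then obtain g where g: "continuous_on (cball 0 1) g" "g ` cball 0 1 \<subseteq> - {0}"
      "\<And>x. x \<in> sphere 0 1 \<Longrightarrow> g x = L x"
    unfolding nullhomotopic_from_sphere_extension by blast
  obtain M where M: "linear M" "\<And>x. M (L x) = x" "\<And>x. L (M x) = x"
    using linear_injective_isomorphism[OF assms] by blast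
  have injM: "inj M"
    using M(3) by (metis injI)
  define h where "h = (\<lambda>x. (1 / norm (M (g x))) *\<^sub>R M (g x))"
  have nz: "M (g x) \<noteq> 0" if "x \<in> cball 0 1" for x
    using g(2) that injM M(1) by (force simp: linear_injective_0)
  have "retraction (cball 0 1) (sphere 0 1) h"
    unfolding retraction_def
  proof (intro conjI)
    have "continuous_on (cball 0 1) (\<lambda>x. M (g x))"
      using continuous_on_compose2[OF linear_continuous_on[of M UNIV] g(1)] M(1)
      by (simp add: linear_conv_bounded_linear)
    then show "continuous_on (cball 0 1) h"
      unfolding h_def using nz by (intro continuous_intros) auto
    show "h \<in> cball 0 1 \<rightarrow> sphere 0 1"
      using nz by (auto simp: h_def)
    show "\<forall>x\<in>sphere 0 1. h x = x"
    proof
      fix x :: 'a assume x: "x \<in> sphere 0 1"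
      then have "M (g x) = x" using g(3) M(2) by simp
      then show "h x = x" using x by (simp add: h_def)
    qed
  qed auto
  then have "sphere (0::'a) 1 retract_of cball 0 1"
    by (auto simp: retract_of_def)
  then show False
    using no_retraction_cball[of 1 "0::'a"] by (simp add: frontier_cball)
qed

text \<open>The degree of \<open>u\<close> restricted to the sphere is the same about \<open>p\<close> and about \<open>q\<close>; a nonsingular
  derivative at the only preimage of \<open>q\<close> makes the latter nonzero, so \<open>p\<close> is attained.\<close>

lemma image_cball_if_unique_regular_preimage:
  fixes u :: "'a::euclidean_space \<Rightarrow> 'a"
  assumes cont: "continuous_on (cball x0 r) u"
    and sph: "\<And>x. x \<in> sphere x0 r \<Longrightarrow> u x \<notin> V"
    and V: "convex V" "p \<in> V" "q \<in> V"
    and x1: "x1 \<in> cball x0 r" "u x1 = q"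
    and uniq: "\<And>x. x \<in> cball x0 r \<Longrightarrow> u x = q \<Longrightarrow> x = x1"
    and der: "(u has_derivative L) (at x1)" "inj L"
  shows "p \<in> u ` cball x0 r"
proof (rule ccontr)
  assume np: "p \<notin> u ` cball x0 r"
  have linL: "linear L" using der(1) has_derivative_linear by blast
  have "x1 \<notin> sphere x0 r" using sph x1 V(3) by blast
  then have x1b: "x1 \<in> ball x0 r" using x1(1) by auto
  have r: "r > 0" using x1b by (metis ball_eq_empty empty_iff not_le)
  obtain B where B: "B > 0" "\<And>x. B * norm x \<le> norm (L x)"
    using linear_inj_bounded_below_pos[OF linL der(2)] by blast
  obtain d where d: "d > 0" "\<And>y. norm (y - x1) < d \<Longrightarrow> norm (u y - u x1 - L (y - x1)) \<le> (B/2) * norm (y - x1)"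
    using der(1)[unfolded has_derivative_at_alt] B(1) by (meson half_gt_zero)
  \<comment> \<open>The bound \<open>d/2\<close> puts the sphere of radius \<open>\<rho>\<close>
    about \<open>x1\<close> where the linear approximation is valid; the other bound keeps it inside
    \<open>cball x0 r\<close>.\<close>
  define \<rho> where "\<rho> = min (d/2) (r - dist x0 x1)"
  have \<rho>: "\<rho> > 0" "\<rho> < d" "dist x0 x1 + \<rho> \<le> r"
    using d x1b by (auto simp: \<rho>_def)
  let ?S = "sphere (0::'a) 1" and ?N = "- {0::'a}"
  have in_sph: "x0 + r *\<^sub>R \<theta> \<in> sphere x0 r" if "\<theta> \<in> ?S" for \<theta>
    using that r by (simp add: dist_norm)
  have in_cb: "x0 + r *\<^sub>R \<theta> \<in> cball x0 r" if "\<theta> \<in> cball 0 1" for \<theta>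
    using that r by (simp add: dist_norm mult_left_le)
  have c1: "continuous_on (cball 0 1) (\<lambda>\<theta>. u (x0 + r *\<^sub>R \<theta>))"
    by (rule continuous_on_compose2[OF cont]) (use in_cb in \<open>auto intro!: continuous_intros\<close>)
  then have c2: "continuous_on ?S (\<lambda>\<theta>. u (x0 + r *\<^sub>R \<theta>))"
    by (rule continuous_on_subset) auto
  \<comment> \<open>As \<open>p\<close> is assumed to be missed, the formula itself extends the
    sphere map over the ball without meeting 0.\<close>
  have null_p: "\<exists>c. homotopic_with_canon (\<lambda>x. True) ?S ?N (\<lambda>\<theta>. u (x0 + r *\<^sub>R \<theta>) - p) (\<lambda>x. c)"
    unfolding nullhomotopic_from_sphere_extension
    by (rule exI[where x="\<lambda>\<theta>. u (x0 + r *\<^sub>R \<theta>) - p"])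
      (use c1 in_cb np in \<open>auto intro!: continuous_intros\<close>)
  \<comment> \<open>Moving the base point along the segment from \<open>q\<close> to
    \<open>p\<close> stays in the convex set \<open>V\<close>, which the image of the sphere
    avoids.\<close>
  have hom_pq: "homotopic_with_canon (\<lambda>x. True) ?S ?N (\<lambda>\<theta>. u (x0 + r *\<^sub>R \<theta>) - q) (\<lambda>\<theta>. u (x0 + r *\<^sub>R \<theta>) - p)"
  proof (rule homotopic_with_linear)
    fix \<theta> :: 'a assume \<theta>: "\<theta> \<in> ?S"
    show "closed_segment (u (x0 + r *\<^sub>R \<theta>) - q) (u (x0 + r *\<^sub>R \<theta>) - p) \<subseteq> ?N"
    proof
      fix z assume "z \<in> closed_segment (u (x0 + r *\<^sub>R \<theta>) - q) (u (x0 + r *\<^sub>R \<theta>) - p)"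
      then obtain t where t: "0 \<le> t" "t \<le> 1"
        "z = (1 - t) *\<^sub>R (u (x0 + r *\<^sub>R \<theta>) - q) + t *\<^sub>R (u (x0 + r *\<^sub>R \<theta>) - p)"
        by (auto simp: closed_segment_def)
      then have "z = u (x0 + r *\<^sub>R \<theta>) - ((1 - t) *\<^sub>R q + t *\<^sub>R p)"
        by (simp add: algebra_simps)
      moreover have "(1 - t) *\<^sub>R q + t *\<^sub>R p \<in> V"
        using V t by (auto intro: convexD)
      ultimately show "z \<in> ?N" using sph[OF in_sph[OF \<theta>]] by auto
    qed
  qed (use c2 in \<open>auto intro!: continuous_intros\<close>)
  \<comment> \<open>The small sphere about \<open>x1\<close> is swept linearly onto the large one
    about \<open>x0\<close>. The sweep stays in the ball and off \<open>x1\<close>, the only point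
    there with value \<open>q\<close>, so \<open>u - q\<close> never vanishes along it.\<close>
  have hom_shrink: "homotopic_with_canon (\<lambda>x. True) ?S ?N (\<lambda>\<theta>. u (x1 + \<rho> *\<^sub>R \<theta>) - q) (\<lambda>\<theta>. u (x0 + r *\<^sub>R \<theta>) - q)"
  proof -
    define P where "P = (\<lambda>z::real\<times>'a. (1 - fst z) *\<^sub>R (x1 + \<rho> *\<^sub>R snd z) + fst z *\<^sub>R (x0 + r *\<^sub>R snd z))"
    have P: "P z \<in> cball x0 r" "P z \<noteq> x1" if "z \<in> {0..1} \<times> ?S" for z
      using nested_cball_step[OF \<rho>(3,1), of "fst z" "snd z"] that by (auto simp: P_def)
    have "continuous_on ({0..1} \<times> ?S) (\<lambda>z. u (P z) - q)"
      by (intro continuous_intros continuous_on_compose2[OF cont])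
        (use P(1) in \<open>auto simp: P_def intro!: continuous_intros\<close>)
    moreover have "(\<lambda>z. u (P z) - q) \<in> {0..1} \<times> ?S \<rightarrow> ?N"
    proof
      fix z :: "real \<times> 'a" assume "z \<in> {0..1} \<times> ?S"
      then show "u (P z) - q \<in> ?N"
        using P[of z] uniq[of "P z"] by auto
    qed
    ultimately show ?thesis
      unfolding homotopic_with_def
      by (intro exI[where x="\<lambda>z. u (P z) - q"]) (auto simp: P_def)
  qed
  \<comment> \<open>The approximation error is at most half of the lower bound
    \<open>B * \<rho>\<close> for the norm of the linear part, so the segment between the two maps
    cannot reach 0.\<close>
  have hom_L: "homotopic_with_canon (\<lambda>x. True) ?S ?N (\<lambda>\<theta>. \<rho> *\<^sub>R L \<theta>) (\<lambda>\<theta>. u (x1 + \<rho> *\<^sub>R \<theta>) - q)"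
  proof (rule homotopic_with_linear)
    show "continuous_on ?S (\<lambda>\<theta>. \<rho> *\<^sub>R L \<theta>)"
      using linL by (intro continuous_intros linear_continuous_on) (simp add: linear_conv_bounded_linear)
    have "x1 + \<rho> *\<^sub>R \<theta> \<in> cball x0 r" if "\<theta> \<in> ?S" for \<theta>
      using nested_cball_step(1)[OF \<rho>(3,1), of 0 \<theta>] that by simp
    then show "continuous_on ?S (\<lambda>\<theta>. u (x1 + \<rho> *\<^sub>R \<theta>) - q)"
      by (intro continuous_intros continuous_on_compose2[OF cont]) (auto intro!: continuous_intros)
    fix \<theta> :: 'a assume \<theta>: "\<theta> \<in> ?S"
    let ?a = "\<rho> *\<^sub>R L \<theta>" and ?b = "u (x1 + \<rho> *\<^sub>R \<theta>) - q"
    have "norm (?b - ?a) \<le> (B / 2) * \<rho>"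
      using d(2)[of "x1 + \<rho> *\<^sub>R \<theta>"] \<theta> \<rho> x1(2) linear_scale[OF linL] by simp
    moreover have "\<rho> * B \<le> norm ?a"
      using B(2)[of \<theta>] \<theta> \<rho>(1) by simp
    ultimately have ab: "norm (?b - ?a) < norm ?a"
      using mult_pos_pos[OF B(1) \<rho>(1)] by (simp add: mult.commute)
    show "closed_segment ?a ?b \<subseteq> ?N"
    proof
      fix z assume "z \<in> closed_segment ?a ?b"
      then obtain t where t: "0 \<le> t" "t \<le> 1" "z = ?a + t *\<^sub>R (?b - ?a)"
        by (auto simp: closed_segment_def algebra_simps)
      then have "norm (z - ?a) \<le> norm (?b - ?a)"
        by (simp add: mult_left_le_one_le)
      with ab show "z \<in> ?N" by auto
    qed
  qed
  have "homotopic_with_canon (\<lambda>x. True) ?S ?N (\<lambda>\<theta>. \<rho> *\<^sub>R L \<theta>) (\<lambda>\<theta>. u (x0 + r *\<^sub>R \<theta>) - p)"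
    using hom_L hom_shrink hom_pq homotopic_with_trans by blast
  then have "\<exists>c. homotopic_with_canon (\<lambda>x. True) ?S ?N (\<lambda>\<theta>. \<rho> *\<^sub>R L \<theta>) (\<lambda>x. c)"
    using null_p homotopic_with_trans by blast
  moreover have "linear (\<lambda>\<theta>. \<rho> *\<^sub>R L \<theta>)" "inj (\<lambda>\<theta>. \<rho> *\<^sub>R L \<theta>)"
    using linL der(2) \<rho>(1) by (auto intro: linear_compose_scale_right simp: inj_def)
  ultimately show False
    using not_nullhomotopic_linear_sphere by blast
qed

section \<open>Image measure under a unit Jacobian\<close>

definition reindex_vec :: "('m::finite \<Rightarrow> 'n::finite) \<Rightarrow> real^'n \<Rightarrow> real^'m" where
  "reindex_vec \<rho> x = (\<chi> i. x $ \<rho> i)"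

lemma reindex_vec_nth [simp]: "reindex_vec \<rho> x $ i = x $ \<rho> i"
  by (simp add: reindex_vec_def)

lemma linear_reindex_vec: "linear (reindex_vec \<rho>)"
  by (rule linearI) (simp_all add: vec_eq_iff)

lemma bounded_linear_reindex_vec: "bounded_linear (reindex_vec \<rho>)"
  using linear_reindex_vec by (simp add: linear_conv_bounded_linear)

lemma reindex_vec_inv:
  assumes "bij \<rho>"
  shows "reindex_vec \<rho> (reindex_vec (inv \<rho>) x) = x" "reindex_vec (inv \<rho>) (reindex_vec \<rho> y) = y"
  using assms by (simp_all add: vec_eq_iff bij_is_inj bij_is_surj surj_f_inv_f)

lemma prod_Basis_cart:
  fixes g :: "real^'n \<Rightarrow> 'c::comm_monoid_mult"
  shows "(\<Prod>b\<in>Basis. g b) = (\<Prod>i\<in>UNIV. g (axis i 1))"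
proof -
  have B: "(Basis :: (real^'n) set) = (\<lambda>i. axis i 1) ` UNIV"
    by (auto simp: Basis_vec_def)
  have "inj (\<lambda>i::'n. axis i (1::real))"
    by (auto simp: inj_def axis_eq_axis)
  then show ?thesis unfolding B by (subst prod.reindex) (auto simp: comp_def)
qed

text \<open>Lebesgue measure is determined by its values on boxes, and the preimage of a box is a
  box with the same side lengths in another order.\<close>

lemma distr_lborel_reindex_vec:
  fixes \<rho> :: "'m::finite \<Rightarrow> 'n::finite"
  assumes "bij \<rho>"
  shows "distr lborel borel (reindex_vec \<rho>) = lborel"
proof (rule sym, rule lborel_eqI)
  have m: "reindex_vec \<rho> \<in> borel_measurable borel"
    by (intro borel_measurable_continuous_onI linear_continuous_on bounded_linear_reindex_vec)
  fix l u :: "real^'m"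
  assume lu: "\<And>b. b \<in> Basis \<Longrightarrow> l \<bullet> b \<le> u \<bullet> b"
  let ?l = "reindex_vec (inv \<rho>) l" and ?u = "reindex_vec (inv \<rho>) u"
  have lu': "l $ i \<le> u $ i" for i
    using lu[of "axis i 1"] by (simp add: inner_axis axis_in_Basis_iff)
  have "reindex_vec \<rho> -` box l u = box ?l ?u"
  proof -
    have "(\<forall>i. l $ i < x $ \<rho> i \<and> x $ \<rho> i < u $ i) \<longleftrightarrow> (\<forall>j. l $ inv \<rho> j < x $ j \<and> x $ j < u $ inv \<rho> j)" for x
      using assms by (metis bij_inv_eq_iff)
    then show ?thesis
      by (auto simp: interval_cart)
  qed
  then have "emeasure (distr lborel borel (reindex_vec \<rho>)) (box l u) = emeasure lborel (box ?l ?u)"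
    using m by (subst emeasure_distr) auto
  also have "\<dots> = (\<Prod>b\<in>Basis. (?u - ?l) \<bullet> b)"
    by (intro emeasure_lborel_box) (auto simp: Basis_vec_def inner_axis lu')
  also have "(\<Prod>b\<in>Basis. (?u - ?l) \<bullet> b) = (\<Prod>j\<in>UNIV. u $ inv \<rho> j - l $ inv \<rho> j)"
    by (simp add: prod_Basis_cart inner_axis)
  also have "\<dots> = (\<Prod>i\<in>UNIV. u $ i - l $ i)"
    using prod.reindex_bij_betw[of "inv \<rho>" UNIV UNIV "\<lambda>i. u $ i - l $ i"] assms
    by (simp add: bij_imp_bij_inv)
  also have "\<dots> = (\<Prod>b\<in>Basis. (u - l) \<bullet> b)"
    by (simp add: prod_Basis_cart inner_axis)
  finally show "emeasure (distr lborel borel (reindex_vec \<rho>)) (box l u) = (\<Prod>b\<in>Basis. (u - l) \<bullet> b)" .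
qed simp

lemma measure_reindex_vec_image:
  fixes \<rho> :: "'m::finite \<Rightarrow> 'n::finite"
  assumes "bij \<rho>" "compact S"
  shows "measure lebesgue (reindex_vec \<rho> ` S) = measure lebesgue S"
proof -
  let ?P = "reindex_vec \<rho>"
  have c: "continuous_on A ?P" for A
    by (intro linear_continuous_on bounded_linear_reindex_vec)
  have "compact (?P ` S)"
    using assms(2) c compact_continuous_image by blast
  then have b: "?P ` S \<in> sets borel" "S \<in> sets borel"
    using assms(2) by (auto intro: borel_compact)
  have "inj ?P" by (metis injI reindex_vec_inv(2)[OF assms(1)])
  then have "?P -` (?P ` S) = S" by (rule inj_vimage_image_eq)
  then have "emeasure lborel (?P ` S) = emeasure lborel S"
    using c b by (subst distr_lborel_reindex_vec[OF assms(1), symmetric], subst emeasure_distr)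
      (auto simp: borel_measurable_continuous_onI)
  then show ?thesis using b by (simp add: measure_def)
qed

text \<open>Transporting permutations along \<open>\<rho>\<close> is a bijection between the two
  symmetric groups that preserves signs, so the Leibniz sums agree term by term.\<close>

lemma det_reindex:
  fixes A :: "'a::comm_ring_1^'n^'n" and \<rho> :: "'m::finite \<Rightarrow> 'n::finite"
  assumes "bij \<rho>"
  shows "det (\<chi> i j. A $ \<rho> i $ \<rho> j) = det A"
proof -
  let ?\<Phi> = "map_permutation (UNIV::'m set) \<rho>"
  have inj: "inj \<rho>" and bb: "bij_betw \<rho> UNIV UNIV" using assms by (auto simp: bij_is_inj)
  have bij: "bij_betw ?\<Phi> {p. p permutes UNIV} {q. q permutes UNIV}"
  proof (rule bij_betw_byWitness[where f'="map_permutation UNIV (inv \<rho>)"])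
    show "\<forall>p\<in>{p. p permutes UNIV}. map_permutation UNIV (inv \<rho>) (?\<Phi> p) = p"
      using bb by (auto intro!: map_permutation_compose_inv simp: inv_f_f[OF inj])
    show "\<forall>q\<in>{q. q permutes UNIV}. ?\<Phi> (map_permutation UNIV (inv \<rho>) q) = q"
      using bij_imp_bij_inv[OF assms] bij_is_surj[OF assms]
      by (auto intro!: map_permutation_compose_inv simp: surj_f_inv_f)
    show "?\<Phi> ` {p. p permutes UNIV} \<subseteq> {q. q permutes UNIV}"
      using bb by (auto intro: map_permutation_permutes)
    show "map_permutation UNIV (inv \<rho>) ` {q. q permutes UNIV} \<subseteq> {p. p permutes UNIV}"
      using bij_imp_bij_inv[OF assms] by (auto intro: map_permutation_permutes)
  qed
  have "det A = (\<Sum>p | p permutes (UNIV::'m set). of_int (sign (?\<Phi> p)) * (\<Prod>i\<in>UNIV. A $ i $ ?\<Phi> p i))"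
    unfolding det_def by (rule sum.reindex_bij_betw[OF bij, symmetric])
  also have "\<dots> = (\<Sum>p | p permutes (UNIV::'m set). of_int (sign p) * (\<Prod>i\<in>UNIV. A $ \<rho> i $ \<rho> (p i)))"
  proof (rule sum.cong[OF refl])
    fix p :: "'m \<Rightarrow> 'm" assume "p \<in> {p. p permutes UNIV}"
    then have s: "sign (?\<Phi> p) = sign p"
      using inj by (intro sign_map_permutation) auto
    have "(\<Prod>i\<in>UNIV. A $ i $ ?\<Phi> p i) = (\<Prod>i\<in>UNIV. A $ \<rho> i $ ?\<Phi> p (\<rho> i))"
      by (rule prod.reindex_bij_betw[OF bb, symmetric])
    then show "of_int (sign (?\<Phi> p)) * (\<Prod>i\<in>UNIV. A $ i $ ?\<Phi> p i) =
        of_int (sign p) * (\<Prod>i\<in>UNIV. A $ \<rho> i $ \<rho> (p i))"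
      using s inj by (simp add: map_permutation_apply)
  qed
  also have "\<dots> = det (\<chi> i j. A $ \<rho> i $ \<rho> j)"
    by (simp add: det_def)
  finally show ?thesis by simp
qed

lemma det_matrix_conj_reindex:
  fixes L :: "real^'n \<Rightarrow> real^'n" and \<rho> :: "'m::finite \<Rightarrow> 'n::finite"
  assumes "bij \<rho>" "linear L"
  shows "det (matrix (reindex_vec \<rho> \<circ> L \<circ> reindex_vec (inv \<rho>))) = det (matrix L)"
proof -
  have "inv \<rho> i = j \<longleftrightarrow> i = \<rho> j" for i j
    using bij_inv_eq_iff[OF assms(1), of j i] by auto
  then have "reindex_vec (inv \<rho>) (axis j (1::real)) = axis (\<rho> j) 1" for j
    unfolding vec_eq_iff by (simp add: axis_def)
  then have "matrix (reindex_vec \<rho> \<circ> L \<circ> reindex_vec (inv \<rho>)) = (\<chi> i j. matrix L $ \<rho> i $ \<rho> j)"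
    by (simp add: matrix_def vec_eq_iff[where 'b='m])
  then show ?thesis using det_reindex[OF assms(1), of "matrix L"] by simp
qed

text \<open>The change of variables theory of the library needs a well-ordered index type; this copy of
  a finite type is ordered by an arbitrary enumeration.\<close>

typedef 'a ordered_copy = "UNIV :: 'a set" by simp

instance ordered_copy :: (finite) finite
proof
  have "(UNIV :: 'a ordered_copy set) = range Abs_ordered_copy"
    by (metis Rep_ordered_copy_inverse surj_def)
  then show "finite (UNIV :: 'a ordered_copy set)" by (metis finite finite_imageI)
qed

definition copy_index :: "'a::finite ordered_copy \<Rightarrow> nat" where
  "copy_index = (SOME f. inj f)"

lemma inj_copy_index: "inj (copy_index :: 'a::finite ordered_copy \<Rightarrow> nat)"
proof -
  have "\<exists>f :: 'a ordered_copy \<Rightarrow> nat. inj f"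
    using finite_imp_inj_to_nat_seg[of "UNIV :: 'a ordered_copy set"] by auto
  then show ?thesis unfolding copy_index_def by (rule someI_ex)
qed

instantiation ordered_copy :: (finite) wellorder
begin

definition "x \<le> y \<longleftrightarrow> copy_index x \<le> copy_index y" for x y :: "'a ordered_copy"
definition "x < y \<longleftrightarrow> copy_index x < copy_index y" for x y :: "'a ordered_copy"

instance
proof
  fix P :: "'a ordered_copy \<Rightarrow> bool" and a
  assume IH: "\<And>x. (\<And>y. y < x \<Longrightarrow> P y) \<Longrightarrow> P x"
  show "P a"
    by (rule measure_induct_rule[of copy_index P a], rule IH) (simp only: less_ordered_copy_def)
qed (auto simp: less_eq_ordered_copy_def less_ordered_copy_def inj_eq[OF inj_copy_index])

end

lemma bij_Rep_ordered_copy: "bij Rep_ordered_copy"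
  by (metis Abs_ordered_copy_inverse Rep_ordered_copy_inverse UNIV_I bij_def injI surj_def)

lemma CARD_ordered_copy: "CARD('a ordered_copy) = CARD('a)"
  using type_definition.card[OF type_definition_ordered_copy] by simp

section \<open>Maps with unit Jacobian do not increase measure\<close>

lemma measure_unit_Jacobian_image_wellorder:
  fixes u :: "real^'n::{finite,wellorder} \<Rightarrow> real^'n::_"
  assumes S: "S \<in> lmeasurable"
    and lip: "\<And>x. x \<in> S \<Longrightarrow> \<exists>T B. open T \<and> x \<in> T \<and> (\<forall>y\<in>S \<inter> T. norm (u y - u x) \<le> B * norm (y - x))"
    and J: "negligible {x \<in> S. \<not> (\<exists>L. (u has_derivative L) (at x) \<and> \<bar>det (matrix L)\<bar> = 1)}"
  shows "measure lebesgue (u ` S) \<le> measure lebesgue S"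
proof -
  define Z where "Z = {x \<in> S. \<not> (\<exists>L. (u has_derivative L) (at x) \<and> \<bar>det (matrix L)\<bar> = 1)}"
  have Z: "negligible Z" "Z \<subseteq> S" using J by (auto simp: Z_def)
  \<comment> \<open>On the exceptional set nothing is known of the derivative; the Lipschitz bound
    alone makes its image null, so only \<open>S - Z\<close> counts.\<close>
  have nuZ: "negligible (u ` Z)"
  proof (rule negligible_locally_Lipschitz_image[OF order_refl Z(1)])
    fix x assume "x \<in> Z"
    then show "\<exists>T B. open T \<and> x \<in> T \<and> (\<forall>y\<in>Z \<inter> T. norm (u y - u x) \<le> B * norm (y - x))"
      using lip[of x] Z(2) by blast
  qed
  have G: "S - Z \<in> lmeasurable"
    using S Z(1) by (simp add: fmeasurable.Diff negligible_imp_measurable)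
  have "\<forall>x\<in>S - Z. \<exists>L. (u has_derivative L) (at x) \<and> \<bar>det (matrix L)\<bar> = 1"
    by (auto simp: Z_def)
  then obtain u' where u': "\<And>x. x \<in> S - Z \<Longrightarrow> (u has_derivative u' x) (at x)"
      "\<And>x. x \<in> S - Z \<Longrightarrow> \<bar>det (matrix (u' x))\<bar> = 1"
    by metis
  have der: "(u has_derivative u' x) (at x within S - Z)" if "x \<in> S - Z" for x
    using u'(1)[OF that] has_derivative_at_withinI by blast
  have "(\<lambda>x. 1::real) integrable_on (S - Z)"
    using G lmeasurable_iff_integrable_on by blast
  then have int: "(\<lambda>x. \<bar>det (matrix (u' x))\<bar>) integrable_on (S - Z)"
    using u'(2) integrable_eq[of "\<lambda>x. 1::real" "S - Z"] by auto
  have "measure lebesgue (u ` S) = measure lebesgue (u ` (S - Z))"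
  proof (rule measure_negligible_symdiff)
    show "u ` (S - Z) \<in> lmeasurable"
      using measurable_bounded_differentiable_image[OF G der int, of 1] u'(2) by auto
    have "sym_diff (u ` (S - Z)) (u ` S) \<subseteq> u ` Z" by auto
    then show "negligible (sym_diff (u ` (S - Z)) (u ` S))"
      using nuZ negligible_subset by blast
  qed
  also have "\<dots> \<le> 1 * measure lebesgue (S - Z)"
    using measure_bounded_differentiable_image[OF G der int, of 1] u'(2) by auto
  also have "\<dots> = measure lebesgue S"
    using measure_negligible_symdiff[OF S, of "S - Z"] Z
    by (simp add: Diff_Diff_Int Int_absorb1)
  finally show ?thesis .
qed

text \<open>Conjugating \<open>u\<close> by the relabelling \<open>P\<close> moves the claim to the
  ordered index type. Measures, local Lipschitz bounds, null sets and Jacobian determinants all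
  survive the conjugation.\<close>

lemma measure_unit_Jacobian_image:
  fixes u :: "real^'n \<Rightarrow> real^'n"
  assumes S: "compact S" and cont: "continuous_on S u"
    and lip: "\<And>x. x \<in> S \<Longrightarrow> \<exists>T B. open T \<and> x \<in> T \<and> (\<forall>y\<in>S \<inter> T. norm (u y - u x) \<le> B * norm (y - x))"
    and J: "negligible {x \<in> S. \<not> (\<exists>L. (u has_derivative L) (at x) \<and> \<bar>det (matrix L)\<bar> = 1)}"
  shows "measure lebesgue (u ` S) \<le> measure lebesgue S"
proof -
  define \<rho> where "\<rho> = (Rep_ordered_copy :: 'n ordered_copy \<Rightarrow> 'n)"
  have \<rho>: "bij \<rho>" by (simp add: \<rho>_def bij_Rep_ordered_copy)
  define P Q where "P = reindex_vec \<rho>" and "Q = reindex_vec (inv \<rho>)"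
  have PQ: "P (Q y) = y" "Q (P x) = x" for x y
    using reindex_vec_inv[OF \<rho>] by (simp_all add: P_def Q_def)
  have bl: "bounded_linear P" "bounded_linear Q"
    by (simp_all add: P_def Q_def bounded_linear_reindex_vec)
  have contP: "continuous_on A P" and contQ: "continuous_on B Q" for A B
    using bl by (simp_all add: linear_continuous_on)
  define w where "w = P \<circ> u \<circ> Q"
  have wP: "w ` P ` S = P ` u ` S" by (simp add: w_def image_comp comp_def PQ)
  have cPS: "compact (P ` S)"
    using S contP compact_continuous_image by blast
  have "measure lebesgue (w ` P ` S) \<le> measure lebesgue (P ` S)"
  proof (rule measure_unit_Jacobian_image_wellorder)
    show "P ` S \<in> lmeasurable" using cPS by (rule lmeasurable_compact)
  next
    obtain CP where CP: "CP > 0" "\<And>x. norm (P x) \<le> norm x * CP"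
      using bounded_linear.pos_bounded[OF bl(1)] by blast
    obtain CQ where CQ: "CQ > 0" "\<And>x. norm (Q x) \<le> norm x * CQ"
      using bounded_linear.pos_bounded[OF bl(2)] by blast
    fix x assume "x \<in> P ` S"
    then have "Q x \<in> S" by (auto simp: PQ)
    from lip[OF this] obtain T B where T: "open T" "Q x \<in> T"
      "\<And>y. y \<in> S \<inter> T \<Longrightarrow> norm (u y - u (Q x)) \<le> B * norm (y - Q x)"
      by auto
    show "\<exists>T B. open T \<and> x \<in> T \<and> (\<forall>y\<in>P ` S \<inter> T. norm (w y - w x) \<le> B * norm (y - x))"
    \<comment> \<open>\<open>CQ\<close> and \<open>CP\<close> bound the norms of the maps applied
      before and after \<open>u\<close>; the absolute value is taken because \<open>B\<close>
      carries no sign condition.\<close>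
    proof (rule exI[where x="Q -` T"], rule exI[where x="\<bar>B\<bar> * CQ * CP"], intro conjI ballI)
      show "open (Q -` T)" by (rule open_vimage[OF T(1) contQ])
      show "x \<in> Q -` T" using T(2) by (rule vimageI2)
      fix y assume y: "y \<in> P ` S \<inter> Q -` T"
      then have "Q y \<in> S \<inter> T" using PQ(2) by auto
      from T(3)[OF this] have "norm (u (Q y) - u (Q x)) \<le> \<bar>B\<bar> * norm (Q y - Q x)"
        by (rule order_trans) (simp add: mult_right_mono)
      also have "\<dots> \<le> \<bar>B\<bar> * (norm (y - x) * CQ)"
        using CQ(2)[of "y - x"] by (intro mult_left_mono) (simp_all add: linear_simps[OF bl(2)])
      finally have "norm (u (Q y) - u (Q x)) * CP \<le> \<bar>B\<bar> * (norm (y - x) * CQ) * CP"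
        using CP(1) by (intro mult_right_mono) auto
      moreover have "norm (w y - w x) \<le> norm (u (Q y) - u (Q x)) * CP"
        using CP(2)[of "u (Q y) - u (Q x)"] by (simp add: w_def linear_simps[OF bl(1)])
      ultimately show "norm (w y - w x) \<le> (\<bar>B\<bar> * CQ * CP) * norm (y - x)"
        by (simp add: mult_ac)
    qed
  next
    let ?Z = "{x \<in> S. \<not> (\<exists>L. (u has_derivative L) (at x) \<and> \<bar>det (matrix L)\<bar> = 1)}"
    have "negligible (P ` ?Z)"
      using J bl(1)
      by (intro negligible_differentiable_image_negligible)
        (auto intro!: bounded_linear_imp_differentiable_on simp: CARD_ordered_copy)
    moreover have "{x \<in> P ` S. \<not> (\<exists>L. (w has_derivative L) (at x) \<and> \<bar>det (matrix L)\<bar> = 1)} \<subseteq> P ` ?Z"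
    proof
      fix x assume x: "x \<in> {x \<in> P ` S. \<not> (\<exists>L. (w has_derivative L) (at x) \<and> \<bar>det (matrix L)\<bar> = 1)}"
      then have "Q x \<in> S" by (auto simp: PQ)
      moreover have False if L: "(u has_derivative L) (at (Q x))" "\<bar>det (matrix L)\<bar> = 1" for L
      proof -
        have "(Q has_derivative Q) (at x)" using bl(2) by (rule bounded_linear_imp_has_derivative)
        from has_derivative_compose[OF this L(1)]
        have "((\<lambda>x. u (Q x)) has_derivative (\<lambda>x. L (Q x))) (at x)" .
        from has_derivative_compose[OF this bounded_linear_imp_has_derivative[OF bl(1)]]
        have "(w has_derivative P \<circ> L \<circ> Q) (at x)" by (simp add: w_def comp_def)
        moreover have "det (matrix (P \<circ> L \<circ> Q)) = det (matrix L)"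
          unfolding P_def Q_def using \<rho> L(1) has_derivative_linear by (blast intro: det_matrix_conj_reindex)
        ultimately show False using x L(2) by auto
      qed
      ultimately have "Q x \<in> ?Z" by auto
      from imageI[OF this, of P] show "x \<in> P ` ?Z" by (simp only: PQ)
    qed
    ultimately show "negligible {x \<in> P ` S. \<not> (\<exists>L. (w has_derivative L) (at x) \<and> \<bar>det (matrix L)\<bar> = 1)}"
      by (rule negligible_subset)
  qed
  moreover have "measure lebesgue (w ` P ` S) = measure lebesgue (u ` S)"
    unfolding wP unfolding P_def using compact_continuous_image[OF cont S] \<rho> by (intro measure_reindex_vec_image)
  moreover have "measure lebesgue (P ` S) = measure lebesgue S"
    unfolding P_def using S \<rho> by (intro measure_reindex_vec_image)
  ultimately show ?thesis by simp
qed

section \<open>Rademacher's theorem\<close>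

lemma frequently_at_0_iff:
  fixes P :: "real \<Rightarrow> bool"
  shows "(\<exists>\<^sub>F h in at 0. P h) \<longleftrightarrow> (\<forall>n::nat. \<exists>h. h \<noteq> 0 \<and> \<bar>h\<bar> < inverse (Suc n) \<and> P h)"
proof
  assume F: "\<exists>\<^sub>F h in at 0. P h"
  show "\<forall>n::nat. \<exists>h. h \<noteq> 0 \<and> \<bar>h\<bar> < inverse (Suc n) \<and> P h"
  proof
    fix n :: nat
    have "\<forall>\<^sub>F h::real in at 0. h \<noteq> 0 \<and> \<bar>h\<bar> < inverse (Suc n)"
      unfolding eventually_at by (rule exI[where x="inverse (Suc n)"]) (auto simp: dist_norm)
    from frequently_eventually_conj[OF F this]
    show "\<exists>h. h \<noteq> 0 \<and> \<bar>h\<bar> < inverse (Suc n) \<and> P h"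
      using frequently_ex by (metis (mono_tags, lifting))
  qed
next
  assume *: "\<forall>n::nat. \<exists>h. h \<noteq> 0 \<and> \<bar>h\<bar> < inverse (Suc n) \<and> P h"
  show "\<exists>\<^sub>F h in at 0. P h"
    unfolding frequently_def
  proof
    assume "\<forall>\<^sub>F h in at 0. \<not> P h"
    then obtain d where d: "d > 0" "\<And>h. h \<noteq> 0 \<Longrightarrow> \<bar>h\<bar> < d \<Longrightarrow> \<not> P h"
      unfolding eventually_at by (auto simp: dist_norm)
    obtain n where "inverse (Suc n) < d" using d(1) reals_Archimedean by blast
    moreover obtain h where "h \<noteq> 0" "\<bar>h\<bar> < inverse (Suc n)" "P h" using * by blast
    ultimately show False using d(2)[of h] by auto
  qed
qed

text \<open>Boundedness makes the lower and upper limits finite, so without a limit they differ. The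
  levels between them are taken rational in order that only countably many pairs arise
  later.\<close>

lemma not_convergent_at_0_oscillates:
  fixes q :: "real \<Rightarrow> real"
  assumes bd: "\<And>h. \<bar>q h\<bar> \<le> M" and nc: "\<nexists>l. (q \<longlongrightarrow> l) (at 0)"
  obtains a b where "a \<in> \<rat>" "b \<in> \<rat>" "a < b" "\<exists>\<^sub>F h in at 0. q h < a" "\<exists>\<^sub>F h in at 0. b < q h"
proof -
  define l u where "l = Liminf (at 0) (\<lambda>h. ereal (q h))" and "u = Limsup (at 0) (\<lambda>h. ereal (q h))"
  have lu: "l \<le> u" unfolding l_def u_def by (rule Liminf_le_Limsup) simp
  have "ereal (- M) \<le> l" unfolding l_def
    by (rule Liminf_bounded) (use bd in \<open>auto intro!: always_eventually simp: abs_le_iff minus_le_iff\<close>)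
  moreover have "u \<le> ereal M" unfolding u_def
    by (rule Limsup_bounded) (use bd in \<open>auto intro!: always_eventually simp: abs_le_iff\<close>)
  ultimately have fin: "\<bar>l\<bar> \<noteq> \<infinity>" using lu by (cases l; cases u) auto
  have "l \<noteq> u"
  proof
    assume "l = u"
    then have "((\<lambda>h. ereal (q h)) \<longlongrightarrow> l) (at 0)"
      by (intro Liminf_eq_Limsup) (simp_all only: l_def[symmetric] u_def[symmetric] trivial_limit_at not_False_eq_True)
    moreover obtain l' where "l = ereal l'" using fin by auto
    ultimately show False using nc by simp
  qed
  with lu have "l < u" by simp
  then obtain c where c: "l < ereal c" "ereal c < u" using ereal_dense2 by blast
  then obtain d where d: "ereal c < ereal d" "ereal d < u" using ereal_dense2 by blast
  \<comment> \<open>The separator \<open>e\<close> forces \<open>a < b\<close> for the rationals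
    chosen on either side of it.\<close>
  obtain e where e: "c < e" "e < d" using d(1) dense[of c d] by auto
  obtain a where a: "a \<in> \<rat>" "c < a" "a < e" using Rats_dense_in_real[OF e(1)] by blast
  obtain b where b: "b \<in> \<rat>" "e < b" "b < d" using Rats_dense_in_real[OF e(2)] by blast
  show thesis
  proof (rule that[OF a(1) b(1)])
    show "a < b" using a b by simp
    show "\<exists>\<^sub>F h in at 0. q h < a"
    proof (rule ccontr)
      assume "\<not> ?thesis"
      then have "\<forall>\<^sub>F h in at 0. ereal a \<le> ereal (q h)" by (simp add: not_frequently not_less)
      then have "ereal a \<le> l" unfolding l_def by (rule Liminf_bounded)
      with c(1) a(2) show False by (metis less_ereal.simps(1) less_trans not_le)
    qed
    show "\<exists>\<^sub>F h in at 0. b < q h"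
    proof (rule ccontr)
      assume "\<not> ?thesis"
      then have "\<forall>\<^sub>F h in at 0. ereal (q h) \<le> ereal b" by (simp add: not_frequently not_less)
      then have "u \<le> ereal b" unfolding u_def by (rule Limsup_bounded)
      with d(2) b(3) show False by (metis less_ereal.simps(1) less_trans not_le)
    qed
  qed
qed

text \<open>Quotients in direction \<open>v\<close> cross the gap from \<open>a\<close> to
  \<open>b\<close> at arbitrarily small scales. For a Lipschitz function, the union over rational
  \<open>a < b\<close> covers the points without a derivative in direction \<open>v\<close>.\<close>

definition osc_set :: "('a::real_normed_vector \<Rightarrow> real) \<Rightarrow> 'a \<Rightarrow> real \<Rightarrow> real \<Rightarrow> 'a set" where
  "osc_set f v a b = {x. (\<exists>\<^sub>F h in at 0. (f (x + h *\<^sub>R v) - f x) / h < a) \<and>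
                         (\<exists>\<^sub>F h in at 0. b < (f (x + h *\<^sub>R v) - f x) / h)}"

text \<open>For each fixed nonzero \<open>h\<close> the quotient is continuous in \<open>x\<close>,
  so even the uncountable union over small \<open>h\<close> is open; only the scales
  \<open>1 / (n + 1)\<close> remain to be intersected, and they are countable.\<close>

lemma osc_set_borel:
  fixes f :: "'a::real_normed_vector \<Rightarrow> real"
  assumes f: "continuous_on UNIV f"
  shows "osc_set f v a b \<in> sets borel"
proof -
  let ?q = "\<lambda>h x. (f (x + h *\<^sub>R v) - f x) / h"
  let ?A = "\<lambda>n. \<Union>h\<in>{h. h \<noteq> 0 \<and> \<bar>h\<bar> < inverse (real (Suc n))}. {x. ?q h x < a}"
  let ?B = "\<lambda>n. \<Union>h\<in>{h. h \<noteq> 0 \<and> \<bar>h\<bar> < inverse (real (Suc n))}. {x. b < ?q h x}"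
  have c: "continuous_on UNIV (\<lambda>x. ?q h x)" if "h \<noteq> 0" for h
    using that by (intro continuous_intros continuous_on_compose2[OF f] f) auto
  have "open (?A n)" "open (?B n)" for n
    using c by (auto intro!: open_UN open_Collect_less simp: continuous_on_const)
  then have "(\<Inter>n. ?A n) \<inter> (\<Inter>n. ?B n) \<in> sets borel" by (intro sets.Int sets.countable_INT') auto
  moreover have "osc_set f v a b = (\<Inter>n. ?A n) \<inter> (\<Inter>n. ?B n)"
    unfolding osc_set_def frequently_at_0_iff by blast
  ultimately show ?thesis by simp
qed

section \<open>Vitali coverings and monotone functions of one variable\<close>

lemma Vitali_intervals:
  fixes S U :: "real set" and R :: "real \<Rightarrow> real \<Rightarrow> bool"
  assumes SU: "S \<subseteq> U" and U: "open U"
    and R: "\<And>x. x \<in> S \<Longrightarrow> \<exists>\<^sub>F h in at 0. R (min x (x + h)) (max x (x + h))"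
  shows "\<exists>C. countable C \<and> (\<forall>(p, q)\<in>C. p < q \<and> {p..q} \<subseteq> U \<and> R p q) \<and>
    disjoint_family_on (\<lambda>(p, q). {p..q}) C \<and> negligible (S - (\<Union>(p, q)\<in>C. {p..q}))"
proof -
  let ?K = "{(p, q). p < q \<and> {p..q} \<subseteq> U \<and> R p q}"
  let ?a = "\<lambda>(p, q). (p + q) / 2 :: real" and ?r = "\<lambda>(p, q). (q - p) / 2 :: real"
  have cb: "cball (?a z) (?r z) = (case z of (p, q) \<Rightarrow> {p..q})" for z
    by (cases z) (simp add: cball_eq_atLeastAtMost field_simps)
  have pos: "0 < ?r z" if "z \<in> ?K" for z using that by auto
  \<comment> \<open>Since \<open>h\<close> may be negative, the interval between \<open>x\<close>
    and \<open>x + h\<close> is written with \<open>min\<close> and \<open>max\<close>. Such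
    intervals are arbitrarily short, so they form a Vitali cover of \<open>S\<close>.\<close>
  have fine: "\<exists>z. z \<in> ?K \<and> x \<in> cball (?a z) (?r z) \<and> ?r z < d" if x: "x \<in> S" and d: "d > 0" for x d
  proof -
    obtain e where e: "e > 0" "ball x e \<subseteq> U" using U SU x open_contains_ball by blast
    obtain n where n: "inverse (real (Suc n)) < min d e"
      using reals_Archimedean[of "min d e"] d e by auto
    obtain h where h: "h \<noteq> 0" "\<bar>h\<bar> < inverse (Suc n)" "R (min x (x + h)) (max x (x + h))"
      using R[OF x] unfolding frequently_at_0_iff by blast
    have "{min x (x + h)..max x (x + h)} \<subseteq> ball x e"
      using h n by (auto simp: dist_norm min_def max_def split: if_splits)
    then have "(min x (x + h), max x (x + h)) \<in> ?K"
      using e(2) h(1,3) by (simp add: subset_trans min_def max_def)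
    moreover have "x \<in> cball (?a (min x (x + h), max x (x + h))) (?r (min x (x + h), max x (x + h)))"
      unfolding cb by simp
    moreover have "?r (min x (x + h), max x (x + h)) < d"
      using h(2) n d by (simp add: min_def max_def split: if_splits; linarith)
    ultimately show ?thesis by (intro exI conjI)
  qed
  obtain C where C: "countable C" "C \<subseteq> ?K"
     "pairwise (\<lambda>i j. disjnt (cball (?a i) (?r i)) (cball (?a j) (?r j))) C"
     "negligible (S - (\<Union>i \<in> C. cball (?a i) (?r i)))"
    by (rule Vitali_covering_theorem_cballs[of ?K ?r S ?a, OF pos fine])
  show ?thesis
  proof (intro exI conjI)
    show "disjoint_family_on (\<lambda>(p, q). {p..q}) C"
      using C(3) unfolding cb by (simp add: disjoint_family_on_def pairwise_def disjnt_def)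
    show "negligible (S - (\<Union>(p, q)\<in>C. {p..q}))" using C(4) unfolding cb .
    show "\<forall>(p, q)\<in>C. p < q \<and> {p..q} \<subseteq> U \<and> R p q" using C(2) by auto
  qed (rule C(1))
qed

lemma emeasure_Union_intervals_mono:
  fixes M N :: "real measure"
  assumes C: "countable C" "disjoint_family_on (\<lambda>(p, q). {p..q}) C"
    and sets: "sets M = sets borel" "sets N = sets borel"
    and le: "\<And>p q. (p, q) \<in> C \<Longrightarrow> emeasure M {p..q} \<le> emeasure N {p..q}"
  shows "emeasure M (\<Union>(p, q)\<in>C. {p..q}) \<le> emeasure N (\<Union>(p, q)\<in>C. {p..q})"
proof -
  have b: "(case z of (p, q) \<Rightarrow> {p..q::real}) \<in> sets borel" for z by (cases z) simp
  have "emeasure M (\<Union>z\<in>C. case z of (p, q) \<Rightarrow> {p..q}) = (\<integral>\<^sup>+z. emeasure M (case z of (p, q) \<Rightarrow> {p..q}) \<partial>count_space C)"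
    using C b sets by (intro emeasure_UN_countable) auto
  also have "\<dots> \<le> (\<integral>\<^sup>+z. emeasure N (case z of (p, q) \<Rightarrow> {p..q}) \<partial>count_space C)"
    using le by (intro nn_integral_mono) auto
  also have "\<dots> = emeasure N (\<Union>z\<in>C. case z of (p, q) \<Rightarrow> {p..q})"
    using C b sets by (intro emeasure_UN_countable[symmetric]) auto
  finally show ?thesis .
qed

text \<open>Reading increments of \<open>g\<close> as a measure lets countable additivity and
  monotonicity replace sums of increments over disjoint intervals.\<close>

lemma emeasure_interval_measure_mono:
  fixes g :: "real \<Rightarrow> real"
  assumes "mono g" "continuous_on UNIV g" "p \<le> q"
  shows "emeasure (interval_measure g) {p..q} = ennreal (g q - g p)"
  using assms by (intro emeasure_interval_measure_Icc) (auto simp: mono_def)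

lemma frequently_slope_min_max:
  fixes g :: "real \<Rightarrow> real"
  assumes "\<exists>\<^sub>F h in at 0. P ((g (x + h) - g x) / h)"
  shows "\<exists>\<^sub>F h in at 0. P ((g (max x (x + h)) - g (min x (x + h))) / (max x (x + h) - min x (x + h)))"
proof -
  have "(g (max x (x + h)) - g (min x (x + h))) / (max x (x + h) - min x (x + h)) = (g (x + h) - g x) / h"
    if "h \<noteq> 0" for h
    using that by (cases "h > 0") (auto simp: min_def max_def divide_simps)
  then show ?thesis using assms unfolding frequently_at_0_iff by metis
qed

lemma emeasure_le_interval_measure_if_slope_gt:
  fixes g :: "real \<Rightarrow> real"
  assumes mono: "mono g" and cont: "continuous_on UNIV g" and b: "b \<ge> 0"
    and S: "S \<in> sets borel" "S \<subseteq> U" and U: "open U"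
    and slope: "\<And>x. x \<in> S \<Longrightarrow> \<exists>\<^sub>F h in at 0. b < (g (x + h) - g x) / h"
  shows "ennreal b * emeasure lborel S \<le> emeasure (interval_measure g) U"
proof -
  have "\<exists>\<^sub>F h in at 0. b < (g (max x (x + h)) - g (min x (x + h))) / (max x (x + h) - min x (x + h))"
    if "x \<in> S" for x
    using frequently_slope_min_max[OF slope[OF that]] .
  from Vitali_intervals[OF S(2) U, where R="\<lambda>p q. b < (g q - g p) / (q - p)", OF this]
  obtain D where D: "countable D" "\<forall>(p, q)\<in>D. p < q \<and> {p..q} \<subseteq> U \<and> b < (g q - g p) / (q - p)"
      "disjoint_family_on (\<lambda>(p, q). {p..q}) D" "negligible (S - (\<Union>(p, q)\<in>D. {p..q}))"
    by blast
  let ?D = "\<Union>(p, q)\<in>D. {p..q}"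
  have DU: "?D \<in> sets borel"
    using D(1) by (intro sets.countable_UN') auto
  have "emeasure lborel (S - ?D) = 0"
    using D(4) S DU by (simp add: negligible_iff_emeasure0)
  moreover have "emeasure lborel S \<le> emeasure lborel (?D \<union> (S - ?D))"
    using S DU by (intro emeasure_mono) auto
  moreover have "\<dots> \<le> emeasure lborel ?D + emeasure lborel (S - ?D)"
    using S DU by (intro emeasure_subadditive) auto
  ultimately have "emeasure lborel S \<le> emeasure lborel ?D"
    by simp
  then have "ennreal b * emeasure lborel S \<le> emeasure (scale_measure (ennreal b) lborel) ?D"
    by (simp add: mult_left_mono)
  also have "\<dots> \<le> emeasure (interval_measure g) ?D"
  proof (rule emeasure_Union_intervals_mono[OF D(1,3)])
    fix p q assume "(p, q) \<in> D"
    then have "p < q" "b < (g q - g p) / (q - p)" using D(2) by auto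
    then show "emeasure (scale_measure (ennreal b) lborel) {p..q} \<le> emeasure (interval_measure g) {p..q}"
      using b by (simp add: emeasure_interval_measure_mono[OF mono cont] ennreal_mult[symmetric] pos_less_divide_eq ennreal_leI less_imp_le)
  qed simp_all
  also have "\<dots> \<le> emeasure (interval_measure g) U"
    using D(2) U by (intro emeasure_mono) (auto simp: borel_open)
  finally show ?thesis .
qed

text \<open>The disjoint intervals of a Vitali cover have increments below \<open>a\<close> times
  their lengths, and these lengths add up to at most the measure of \<open>U\<close>. The cover is
  returned as an open set so that a second Vitali covering can be made inside it.\<close>

lemma interval_measure_le_emeasure_if_slope_less:
  fixes g :: "real \<Rightarrow> real"
  assumes mono: "mono g" and cont: "continuous_on UNIV g" and a: "a > 0"
    and S: "S \<in> sets borel" "S \<subseteq> U" and U: "open U"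
    and slope: "\<And>x. x \<in> S \<Longrightarrow> \<exists>\<^sub>F h in at 0. (g (x + h) - g x) / h < a"
  obtains U' where "open U'" "emeasure lborel (S - U') = 0"
    "emeasure (interval_measure g) U' \<le> ennreal a * emeasure lborel U"
proof -
  have "\<exists>\<^sub>F h in at 0. (g (max x (x + h)) - g (min x (x + h))) / (max x (x + h) - min x (x + h)) < a"
    if "x \<in> S" for x
    using frequently_slope_min_max[OF slope[OF that]] .
  from Vitali_intervals[OF S(2) U, where R="\<lambda>p q. (g q - g p) / (q - p) < a", OF this]
  obtain C where C: "countable C" "\<forall>(p, q)\<in>C. p < q \<and> {p..q} \<subseteq> U \<and> (g q - g p) / (q - p) < a"
      "disjoint_family_on (\<lambda>(p, q). {p..q}) C" "negligible (S - (\<Union>(p, q)\<in>C. {p..q}))"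
    by blast
  let ?C = "\<Union>(p, q)\<in>C. {p..q}"
  have CU: "?C \<in> sets borel"
    using C(1) by (intro sets.countable_UN') auto
  define U' where "U' = (\<Union>(p, q)\<in>C. {p<..<q})"
  have U': "open U'" "U' \<subseteq> ?C" by (auto simp: U'_def)
  \<comment> \<open>Passing to open intervals loses only countably many endpoints.\<close>
  have "S - U' \<subseteq> (S - ?C) \<union> (\<Union>(p, q)\<in>C. {p, q})"
    by (force simp: U'_def)
  moreover have "negligible (\<Union>(p, q)\<in>C. {p, q})"
    using C(1) by (auto simp: negligible_iff_null_sets case_prod_unfold intro!: null_sets_UN')
  ultimately have "negligible (S - U')"
    using C(4) negligible_Un negligible_subset by blast
  then have SU': "emeasure lborel (S - U') = 0"
    using S U'(1) by (simp add: negligible_iff_emeasure0 borel_open)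
  have "emeasure (interval_measure g) U' \<le> emeasure (interval_measure g) ?C"
    using CU U' by (intro emeasure_mono) auto
  also have "\<dots> \<le> emeasure (scale_measure (ennreal a) lborel) ?C"
  proof (rule emeasure_Union_intervals_mono[OF C(1,3)])
    fix p q assume "(p, q) \<in> C"
    then have "p < q" "(g q - g p) / (q - p) < a" using C(2) by auto
    then show "emeasure (interval_measure g) {p..q} \<le> emeasure (scale_measure (ennreal a) lborel) {p..q}"
      using a by (simp add: emeasure_interval_measure_mono[OF mono cont] ennreal_mult[symmetric] pos_divide_less_eq ennreal_leI less_imp_le)
  qed simp_all
  also have "\<dots> \<le> ennreal a * emeasure lborel U"
  proof -
    have "emeasure lborel ?C \<le> emeasure lborel U"
      using C(2) U by (intro emeasure_mono) (auto simp: borel_open)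
    then show ?thesis by (auto intro!: mult_left_mono)
  qed
  finally show thesis using that U' SU' by blast
qed

text \<open>Cover \<open>S\<close> by intervals of slope below \<open>a\<close> inside an open set of measure at most \<open>m + \<epsilon>\<close>, then by intervals
  of slope above \<open>b\<close> inside the first cover: comparing increments of \<open>g\<close> gives \<open>b * m \<le> a * (m + \<epsilon>)\<close>.\<close>

lemma osc_set_mono_null:
  fixes g :: "real \<Rightarrow> real"
  assumes mono: "mono g" and cont: "continuous_on UNIV g" and ab: "a < b"
  shows "emeasure lborel (osc_set g 1 a b) = 0"
proof (cases "a \<le> 0")
  case True
  have "(g (x + h) - g x) / h \<ge> 0" for x h
    using mono by (cases "h \<ge> 0") (auto simp: mono_def zero_le_divide_iff)
  with True have "\<not> (g (x + h) - g x) / h < a" for x h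
    by (meson dual_order.trans not_le)
  then have "osc_set g 1 a b = {}" by (simp add: osc_set_def)
  then show ?thesis by simp
next
  case False
  let ?N = "osc_set g 1 a b"
  have N: "?N \<in> sets borel" by (rule osc_set_borel[OF cont])
  \<comment> \<open>Cutting down to a bounded piece makes the measure finite, so that the final
    inequality can be read among real numbers.\<close>
  have null: "emeasure lborel (?N \<inter> ball (0::real) (real n)) = 0" for n
  proof -
    define S where "S = ?N \<inter> ball (0::real) (real n)"
    have S: "S \<in> sets borel" using N by (simp add: S_def)
    have slopes: "\<exists>\<^sub>F h in at 0. (g (x + h) - g x) / h < a" "\<exists>\<^sub>F h in at 0. b < (g (x + h) - g x) / h"
      if "x \<in> S" for x
      using that by (simp_all add: S_def osc_set_def)
    have "emeasure lborel S \<le> emeasure lborel (ball (0::real) (real n))"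
      by (rule emeasure_mono) (auto simp: S_def)
    then have Sfin: "emeasure lborel S < \<infinity>"
      using emeasure_lborel_ball_finite[of "0::real" "real n"] by (simp add: order_le_less_trans)
    define m where "m = measure lborel S"
    have m: "emeasure lborel S = ennreal m" "m \<ge> 0"
      using Sfin by (simp_all add: m_def emeasure_eq_ennreal_measure less_top)
    have "b * m \<le> a * (m + \<epsilon>)" if \<epsilon>: "\<epsilon> > 0" for \<epsilon>
    proof -
      obtain U where U: "open U" "S \<subseteq> U" "emeasure lborel (U - S) < ennreal \<epsilon>"
        using outer_regular_lborel[OF S \<epsilon>] by auto
      have "emeasure lborel U = emeasure lborel S + emeasure lborel (U - S)"
        using U S by (subst plus_emeasure) (auto simp: Un_absorb1)
      also have "\<dots> \<le> ennreal m + ennreal \<epsilon>"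
        using U(3) by (intro add_mono) (auto simp: m less_imp_le)
      finally have Um: "emeasure lborel U \<le> ennreal (m + \<epsilon>)"
        using \<epsilon> m by (simp add: ennreal_plus)
      obtain U' where U': "open U'" "emeasure lborel (S - U') = 0"
          "emeasure (interval_measure g) U' \<le> ennreal a * emeasure lborel U"
        using interval_measure_le_emeasure_if_slope_less[OF mono cont _ S U(2,1) slopes(1)] False by auto
      have "emeasure lborel S = emeasure lborel (S \<inter> U') + emeasure lborel (S - U')"
        using S U'(1) by (subst plus_emeasure) (auto simp: borel_open Int_Diff_Un)
      \<comment> \<open>The steep intervals must lie in \<open>U'\<close>, so they are chosen for
        \<open>S \<inter> U'\<close>, which has the same measure as \<open>S\<close>.\<close>
      then have "ennreal b * ennreal m = ennreal b * emeasure lborel (S \<inter> U')"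
        using U'(2) m(1) by simp
      also have "\<dots> \<le> emeasure (interval_measure g) U'"
        using S U'(1) slopes(2) False ab
        by (intro emeasure_le_interval_measure_if_slope_gt[OF mono cont]) (auto simp: borel_open)
      also note U'(3)
      also have "ennreal a * emeasure lborel U \<le> ennreal a * ennreal (m + \<epsilon>)"
        using Um by (rule mult_left_mono) simp
      finally show "b * m \<le> a * (m + \<epsilon>)"
        using False ab \<epsilon> m(2) by (simp add: ennreal_mult[symmetric] del: ennreal_plus)
    qed
    from this[of "e / a" for e] have "b * m \<le> a * m + e" if "e > 0" for e
      using that False by (simp add: distrib_left)
    then have "b * m \<le> a * m" by (rule field_le_epsilon)
    then have "(b - a) * m \<le> 0" by (simp add: algebra_simps)
    then have "m = 0" using ab m(2) by (simp add: mult_le_0_iff)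
    then show ?thesis using m by (simp add: S_def)
  qed
  have "?N = (\<Union>n. ?N \<inter> ball (0::real) (real n))"
    using reals_Archimedean2 by (auto simp: dist_norm)
  moreover have "emeasure lborel (\<Union>n. ?N \<inter> ball (0::real) (real n)) = 0"
    using null N by (intro emeasure_UN_eq_0) auto
  ultimately show ?thesis by simp
qed

text \<open>Adding \<open>L * x\<close> makes the function monotone and shifts every difference
  quotient by \<open>L\<close>, hence only shifts the two levels.\<close>

lemma osc_set_Lipschitz_real_null:
  fixes f :: "real \<Rightarrow> real"
  assumes f: "L-lipschitz_on UNIV f" and ab: "a < b"
  shows "emeasure lborel (osc_set f 1 a b) = 0"
proof -
  define g where "g = (\<lambda>x. f x + L * x)"
  have cont: "continuous_on UNIV g"
    unfolding g_def by (intro continuous_intros lipschitz_on_continuous_on[OF f])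
  have mono: "mono g"
  proof (rule monoI)
    fix x y :: real assume "x \<le> y"
    then have "\<bar>f x - f y\<bar> \<le> L * (y - x)"
      using lipschitz_onD[OF f, of x y] by (simp add: dist_real_def)
    then show "g x \<le> g y" by (simp add: g_def algebra_simps abs_le_iff)
  qed
  have slope: "(g (x + h) - g x) / h = (f (x + h) - f x) / h + L" if "h \<noteq> 0" for x h
    using that by (simp add: g_def field_simps)
  have "(\<exists>\<^sub>F h in at 0. P ((g (x + h) - g x) / h)) \<longleftrightarrow> (\<exists>\<^sub>F h in at 0. P ((f (x + h) - f x) / h + L))" for P x
    unfolding frequently_at_0_iff
    by (intro all_cong1 ex_cong1 conj_cong refl) (simp add: slope)
  from this[of "\<lambda>s. s < a + L"] this[of "\<lambda>s. b + L < s"]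
  have "osc_set f 1 a b = osc_set g 1 (a + L) (b + L)"
    by (simp add: osc_set_def)
  then show ?thesis using osc_set_mono_null[OF mono cont, of "a + L" "b + L"] ab by simp
qed

text \<open>Fubini without rotating coordinates: integrate the indicator of \<open>N\<close> at \<open>x + t *\<^sub>R v\<close>, first in \<open>x\<close>
  (translation invariance) and first in \<open>t\<close>.\<close>

lemma emeasure_eq_0_if_null_on_lines:
  fixes N :: "'a::euclidean_space set"
  assumes N: "N \<in> sets borel" and lines: "\<And>x. emeasure lborel {t. x + t *\<^sub>R v \<in> N} = 0"
  shows "emeasure lborel N = 0"
proof -
  \<comment> \<open>The cut-off to the unit interval gives the parameter \<open>t\<close> total
    weight 1, so integrating over \<open>t\<close> after \<open>x\<close> returns exactly the
    measure of \<open>N\<close>.\<close>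
  let ?\<phi> = "\<lambda>(x, t::real). indicator N (x + t *\<^sub>R v) * indicator {0..1} t :: ennreal"
  have N'[measurable]: "N \<in> sets lborel" using N by simp
  have m: "?\<phi> \<in> borel_measurable (lborel \<Otimes>\<^sub>M lborel)"
    by measurable
  have inner_x: "(\<integral>\<^sup>+x. indicator N (x + t *\<^sub>R v) \<partial>lborel) = emeasure lborel N" for t
  proof -
    have "emeasure lborel N = (\<integral>\<^sup>+x. indicator N x \<partial>distr lborel borel ((+) (t *\<^sub>R v)))"
      using N by (simp add: lborel_distr_plus)
    also have "\<dots> = (\<integral>\<^sup>+x. indicator N (t *\<^sub>R v + x) \<partial>lborel)"
      using N by (subst nn_integral_distr) auto
    finally show ?thesis by (simp add: add.commute)
  qed
  have inner_t: "(\<integral>\<^sup>+t. ?\<phi> (x, t) \<partial>lborel) = 0" for x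
  proof -
    have M: "{t. x + t *\<^sub>R v \<in> N} \<in> sets borel"
      using N measurable_sets[of "\<lambda>t. x + t *\<^sub>R v" borel borel N] by (auto simp: vimage_def)
    have "(\<integral>\<^sup>+t. ?\<phi> (x, t) \<partial>lborel) \<le> (\<integral>\<^sup>+t. indicator {t. x + t *\<^sub>R v \<in> N} t \<partial>lborel)"
      by (intro nn_integral_mono) (auto simp: indicator_def)
    also have "\<dots> = 0" using lines[of x] M by simp
    finally show ?thesis by simp
  qed
  have "emeasure lborel N = (\<integral>\<^sup>+t. emeasure lborel N * indicator {0..1::real} t \<partial>lborel)"
    by (simp add: nn_integral_cmult)
  also have "\<dots> = (\<integral>\<^sup>+t. \<integral>\<^sup>+x. ?\<phi> (x, t) \<partial>lborel \<partial>lborel)"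
    by (simp add: nn_integral_multc inner_x)
  also have "\<dots> = (\<integral>\<^sup>+x. \<integral>\<^sup>+t. ?\<phi> (x, t) \<partial>lborel \<partial>lborel)"
    using lborel_pair.Fubini'[OF m] by simp
  also have "\<dots> = 0" by (simp add: inner_t[simplified])
  finally show ?thesis .
qed

lemma osc_set_Lipschitz_null:
  fixes f :: "'a::euclidean_space \<Rightarrow> real"
  assumes f: "L-lipschitz_on UNIV f" and ab: "a < b"
  shows "emeasure lborel (osc_set f v a b) = 0"
proof (rule emeasure_eq_0_if_null_on_lines)
  show "osc_set f v a b \<in> sets borel"
    by (rule osc_set_borel[OF lipschitz_on_continuous_on[OF f]])
  fix x
  have "(L * norm v)-lipschitz_on UNIV (\<lambda>t. f (x + t *\<^sub>R v))"
  proof (rule lipschitz_onI)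
    fix s t :: real
    have "dist (x + s *\<^sub>R v) (x + t *\<^sub>R v) = norm v * dist s t"
      by (simp add: dist_norm flip: scaleR_diff_left)
    then show "dist (f (x + s *\<^sub>R v)) (f (x + t *\<^sub>R v)) \<le> L * norm v * dist s t"
      using lipschitz_onD[OF f, of "x + s *\<^sub>R v" "x + t *\<^sub>R v"] by (simp add: dist_real_def mult_ac)
  qed (use lipschitz_on_nonneg[OF f] in simp)
  from osc_set_Lipschitz_real_null[OF this ab]
  have "emeasure lborel (osc_set (\<lambda>t. f (x + t *\<^sub>R v)) 1 a b) = 0" .
  moreover have "{t. x + t *\<^sub>R v \<in> osc_set f v a b} = osc_set (\<lambda>t. f (x + t *\<^sub>R v)) 1 a b"
    by (simp add: osc_set_def algebra_simps)
  ultimately show "emeasure lborel {t. x + t *\<^sub>R v \<in> osc_set f v a b} = 0" by simp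
qed

section \<open>Directional derivatives and their linearity almost everywhere\<close>

definition quot :: "('a::real_normed_vector \<Rightarrow> real) \<Rightarrow> 'a \<Rightarrow> 'a \<Rightarrow> real \<Rightarrow> real" where
  "quot f v x h = (f (x + h *\<^sub>R v) - f x) / h"

lemma quot_Lipschitz_bound:
  assumes f: "L-lipschitz_on UNIV f"
  shows "\<bar>quot f v x h\<bar> \<le> L * norm v"
proof (cases "h = 0")
  case False
  have "\<bar>f (x + h *\<^sub>R v) - f x\<bar> \<le> L * (\<bar>h\<bar> * norm v)"
    using lipschitz_onD[OF f, of "x + h *\<^sub>R v" x] by (simp add: dist_norm)
  with False show ?thesis by (simp add: quot_def field_simps)
qed (use lipschitz_on_nonneg[OF f] in \<open>simp add: quot_def\<close>)

text \<open>A bounded quotient without a limit oscillates between two rationals, so the exceptional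
  set lies in a countable union of null oscillation sets.\<close>

lemma AE_directional_derivative_exists:
  fixes f :: "'a::euclidean_space \<Rightarrow> real"
  assumes f: "L-lipschitz_on UNIV f"
  shows "AE x in lborel. \<exists>l. (quot f v x \<longlongrightarrow> l) (at 0)"
proof -
  let ?I = "{(a, b). a \<in> \<rat> \<and> b \<in> \<rat> \<and> a < (b::real)}"
  have "?I \<subseteq> \<rat> \<times> \<rat>" by auto
  then have cI: "countable ?I" by (rule countable_subset) (intro countable_SIGMA countable_rat)
  have "AE x in lborel. \<forall>z\<in>?I. x \<notin> osc_set f v (fst z) (snd z)"
  proof (subst AE_ball_countable[OF cI], rule ballI)
    fix z assume "z \<in> ?I"
    then have "osc_set f v (fst z) (snd z) \<in> null_sets lborel"
      using osc_set_Lipschitz_null[OF f] osc_set_borel[OF lipschitz_on_continuous_on[OF f]]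
      by (intro null_setsI) auto
    then show "AE x in lborel. x \<notin> osc_set f v (fst z) (snd z)" by (rule AE_not_in)
  qed
  then show ?thesis
  proof (rule AE_mp[OF _ AE_I2], intro impI)
    fix x assume x: "\<forall>z\<in>?I. x \<notin> osc_set f v (fst z) (snd z)"
    show "\<exists>l. (quot f v x \<longlongrightarrow> l) (at 0)"
    proof (rule ccontr)
      assume "\<not> ?thesis"
      then obtain a b where "a \<in> \<rat>" "b \<in> \<rat>" "a < b" "\<exists>\<^sub>F h in at 0. quot f v x h < a"
          "\<exists>\<^sub>F h in at 0. b < quot f v x h"
        using not_convergent_at_0_oscillates[of "quot f v x", OF quot_Lipschitz_bound[OF f]] by blast
      then show False using x by (force simp: osc_set_def quot_def)
    qed
  qed
qed

text \<open>The positive and negative parts of \<open>h\<close> are densities of two measures that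
  agree on boxes. Boxes are stable under intersection, generate the Borel sets and exhaust the space
  with finite measure, so the measures agree, and then so do their densities almost
  everywhere.\<close>

lemma AE_eq_0_if_integral_box_eq_0:
  fixes h :: "'a::euclidean_space \<Rightarrow> real"
  assumes h: "h \<in> borel_measurable borel"
    and int: "\<And>a b. integrable lborel (\<lambda>x. indicator (box a b) x * h x)"
    and zero: "\<And>a b. (\<integral>x. indicator (box a b) x * h x \<partial>lborel) = 0"
  shows "AE x in lborel. h x = 0"
proof -
  have hm[measurable]: "h \<in> borel_measurable lborel" using h by simp
  let ?P = "\<lambda>x. ennreal (max 0 (h x))" and ?N = "\<lambda>x. ennreal (max 0 (- h x))"
  have box: "emeasure (density lborel ?P) (box a b) = ennreal (\<integral>x. indicator (box a b) x * max 0 (h x) \<partial>lborel)"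
            "emeasure (density lborel ?N) (box a b) = ennreal (\<integral>x. indicator (box a b) x * max 0 (- h x) \<partial>lborel)"
            "(\<integral>x. indicator (box a b) x * max 0 (h x) \<partial>lborel) = (\<integral>x. indicator (box a b) x * max 0 (- h x) \<partial>lborel)"
    for a b :: 'a
  proof -
    have iP: "integrable lborel (\<lambda>x. indicator (box a b) x * max 0 (h x))"
      by (rule Bochner_Integration.integrable_bound[OF int[of a b]]) (auto simp: indicator_def)
    have iN: "integrable lborel (\<lambda>x. indicator (box a b) x * max 0 (- h x))"
      by (rule Bochner_Integration.integrable_bound[OF int[of a b]]) (auto simp: indicator_def)
    have "emeasure (density lborel ?P) (box a b) = (\<integral>\<^sup>+x. ennreal (indicator (box a b) x * max 0 (h x)) \<partial>lborel)"
      by (subst emeasure_density) (auto intro!: nn_integral_cong simp: indicator_def)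
    also have "\<dots> = ennreal (\<integral>x. indicator (box a b) x * max 0 (h x) \<partial>lborel)"
      by (rule nn_integral_eq_integral[OF iP]) simp
    finally show "emeasure (density lborel ?P) (box a b) = ennreal (\<integral>x. indicator (box a b) x * max 0 (h x) \<partial>lborel)" .
    have "emeasure (density lborel ?N) (box a b) = (\<integral>\<^sup>+x. ennreal (indicator (box a b) x * max 0 (- h x)) \<partial>lborel)"
      by (subst emeasure_density) (auto intro!: nn_integral_cong simp: indicator_def)
    also have "\<dots> = ennreal (\<integral>x. indicator (box a b) x * max 0 (- h x) \<partial>lborel)"
      by (rule nn_integral_eq_integral[OF iN]) simp
    finally show "emeasure (density lborel ?N) (box a b) = ennreal (\<integral>x. indicator (box a b) x * max 0 (- h x) \<partial>lborel)" .
    have "(\<integral>x. indicator (box a b) x * max 0 (h x) \<partial>lborel) - (\<integral>x. indicator (box a b) x * max 0 (- h x) \<partial>lborel)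
        = (\<integral>x. indicator (box a b) x * max 0 (h x) - indicator (box a b) x * max 0 (- h x) \<partial>lborel)"
      by (rule Bochner_Integration.integral_diff[OF iP iN, symmetric])
    also have "\<dots> = (\<integral>x. indicator (box a b) x * h x \<partial>lborel)"
      by (intro Bochner_Integration.integral_cong) (auto simp: indicator_def)
    finally show "(\<integral>x. indicator (box a b) x * max 0 (h x) \<partial>lborel) = (\<integral>x. indicator (box a b) x * max 0 (- h x) \<partial>lborel)"
      using zero by simp
  qed
  have "density lborel ?P = density lborel ?N"
  proof (rule measure_eqI_generator_eq)
    let ?E = "range (\<lambda>(a, b). box a b :: 'a set)"
    show "Int_stable ?E" by (auto simp: Int_stable_def box_Int_box)
    show "?E \<subseteq> Pow UNIV" "sets (density lborel ?P) = sigma_sets UNIV ?E" "sets (density lborel ?N) = sigma_sets UNIV ?E"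
      by (simp_all add: borel_eq_box)
    let ?A = "\<lambda>n::nat. box (- (real n *\<^sub>R One)) (real n *\<^sub>R One) :: 'a set"
    show "range ?A \<subseteq> ?E" "(\<Union>i. ?A i) = UNIV"
      unfolding UN_box_eq_UNIV by auto
    show "emeasure (density lborel ?P) (?A i) \<noteq> \<infinity>" for i by (simp add: box)
    show "emeasure (density lborel ?P) X = emeasure (density lborel ?N) X" if "X \<in> ?E" for X
      using that by (auto simp: box)
  qed
  then have "AE x in lborel. ?P x = ?N x"
    by (intro sigma_finite_measure.density_unique[OF sigma_finite_lborel]) simp_all
  then show ?thesis
    by (rule AE_mp) (auto intro!: AE_I2 simp: max_def ennreal_eq_0_iff split: if_splits)
qed

abbreviation step :: "nat \<Rightarrow> real" where "step n \<equiv> inverse (real (Suc n))"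

text \<open>A limit along one fixed sequence of steps gives a function that is defined everywhere
  and Borel measurable for continuous \<open>f\<close>; it equals the two-sided directional
  derivative wherever that exists.\<close>

definition dir_deriv :: "('a::real_normed_vector \<Rightarrow> real) \<Rightarrow> 'a \<Rightarrow> 'a \<Rightarrow> real" where
  "dir_deriv f v x = lim (\<lambda>n. quot f v x (step n))"

lemma quot_step_tendsto:
  assumes "(quot f v x \<longlongrightarrow> l) (at 0)"
  shows "(\<lambda>n. quot f v x (step n)) \<longlonglongrightarrow> l"
proof -
  have "filterlim step (at 0) sequentially"
    using LIMSEQ_inverse_real_of_nat by (simp add: filterlim_at)
  then show ?thesis using assms by (rule filterlim_compose[rotated])
qed

lemma dir_deriv_eqI:
  "(quot f v x \<longlongrightarrow> l) (at 0) \<Longrightarrow> dir_deriv f v x = l"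
  unfolding dir_deriv_def by (intro limI quot_step_tendsto)

lemma AE_dir_deriv:
  fixes f :: "'a::euclidean_space \<Rightarrow> real"
  assumes "L-lipschitz_on UNIV f"
  shows "AE x in lborel. (quot f v x \<longlongrightarrow> dir_deriv f v x) (at 0)"
  using AE_directional_derivative_exists[OF assms, of v]
  by (rule AE_mp) (auto intro!: AE_I2 dest: dir_deriv_eqI)

lemma measurable_quot [measurable]:
  fixes f :: "'a::euclidean_space \<Rightarrow> real"
  assumes "continuous_on UNIV f"
  shows "(\<lambda>x. quot f v x h) \<in> borel_measurable borel"
  unfolding quot_def
  by (cases "h = 0", simp)
    (intro borel_measurable_continuous_onI continuous_intros continuous_on_compose2[OF assms]; simp)

lemma measurable_dir_deriv [measurable]:
  fixes f :: "'a::euclidean_space \<Rightarrow> real"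
  assumes "continuous_on UNIV f"
  shows "dir_deriv f v \<in> borel_measurable borel"
  unfolding dir_deriv_def[abs_def] by (intro borel_measurable_lim_metric measurable_quot assms)

text \<open>Averaged over a box, the failure of additivity of the difference quotients is the average of a bounded
  function over a box minus its average over the box translated by \<open>t *\<^sub>R w\<close>, hence tends to zero.\<close>

lemma AE_dir_deriv_add:
  fixes f :: "'a::euclidean_space \<Rightarrow> real"
  assumes f: "L-lipschitz_on UNIV f"
  shows "AE x in lborel. dir_deriv f (v + w) x = dir_deriv f v x + dir_deriv f w x"
proof -
  have cont: "continuous_on UNIV f" by (rule lipschitz_on_continuous_on[OF f])
  note [measurable] = measurable_quot[OF cont] measurable_dir_deriv[OF cont]
  define g where "g = (\<lambda>n x. quot f (v + w) x (step n) - quot f v x (step n) - quot f w x (step n))"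
  define h where "h = (\<lambda>x. dir_deriv f (v + w) x - dir_deriv f v x - dir_deriv f w x)"
  define M where "M = L * norm (v + w) + L * norm v + L * norm w"
  have gm[measurable]: "g n \<in> borel_measurable borel" for n unfolding g_def by measurable
  have hm[measurable]: "h \<in> borel_measurable borel" unfolding h_def by measurable
  have gM: "\<bar>g n x\<bar> \<le> M" for n x
    using quot_Lipschitz_bound[OF f, of "v + w" x "step n"] quot_Lipschitz_bound[OF f, of v x "step n"]
      quot_Lipschitz_bound[OF f, of w x "step n"] by (simp add: g_def M_def)
  have lim: "AE x in lborel. (\<lambda>n. g n x) \<longlonglongrightarrow> h x"
    using AE_dir_deriv[OF f, of "v + w"] AE_dir_deriv[OF f, of v] AE_dir_deriv[OF f, of w]
  proof eventually_elim
    case (elim x)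
    then show ?case unfolding g_def h_def by (intro tendsto_diff quot_step_tendsto)
  qed
  \<comment> \<open>Among the terms of the additivity defect,
    \<open>f (x + h *\<^sub>R (v + w)) - f (x + h *\<^sub>R w)\<close> is an increment in direction
    \<open>v\<close> based at the shifted point.\<close>
  have g_eq: "g n x = quot f v (x + step n *\<^sub>R w) (step n) - quot f v x (step n)" for n x
    by (simp add: g_def quot_def algebra_simps diff_divide_distrib add_divide_distrib)
  have fin: "integrable lborel (indicator (box a b) :: 'a \<Rightarrow> real)" for a b
    by (intro integrable_real_indicator) (simp_all add: emeasure_lborel_box_eq)
  have dc: "integrable lborel (\<lambda>x. indicator (box a b) x * h x)"
           "(\<lambda>n. \<integral>x. indicator (box a b) x * g n x \<partial>lborel) \<longlonglongrightarrow> (\<integral>x. indicator (box a b) x * h x \<partial>lborel)"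
           "integrable lborel (\<lambda>x. indicator (box a b) x * g n x)" for a b n
  proof -
    have w: "integrable lborel (\<lambda>x. M * indicator (box a b) x :: real)"
      using fin by simp
    have l: "AE x in lborel. (\<lambda>n. indicator (box a b) x * g n x) \<longlonglongrightarrow> indicator (box a b) x * h x"
      using lim by eventually_elim (rule tendsto_mult_left)
    have bd: "AE x in lborel. norm (indicator (box a b) x * g n x) \<le> M * indicator (box a b) x" for n
      using gM by (auto simp: indicator_def)
    show "integrable lborel (\<lambda>x. indicator (box a b) x * h x)"
      by (rule integrable_dominated_convergence[OF _ _ w l bd]) measurable
    show "(\<lambda>n. \<integral>x. indicator (box a b) x * g n x \<partial>lborel) \<longlonglongrightarrow> (\<integral>x. indicator (box a b) x * h x \<partial>lborel)"
      by (rule integral_dominated_convergence[OF _ _ w l bd]) measurable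
    show "integrable lborel (\<lambda>x. indicator (box a b) x * g n x)"
      by (rule Bochner_Integration.integrable_bound[OF w]) (use gM in \<open>auto simp: indicator_def intro: order_trans[OF _ abs_ge_self]\<close>)
  qed
  have "(\<integral>x. indicator (box a b) x * h x \<partial>lborel) = 0" for a b
  proof -
    let ?Q = "box a b"
    \<comment> \<open>The translation is moved from the quotient to the box: the integrand lives
      where the box and its translate differ.\<close>
    define d where "d = (\<lambda>n y. (indicator ?Q (y - step n *\<^sub>R w) - indicator ?Q y) * quot f v y (step n) :: real)"
    obtain R where R: "?Q \<subseteq> ball 0 R" using bounded_box bounded_subset_ballD by blast
    \<comment> \<open>All steps are at most 1, so one ball holds the box and all its translates and
      supplies a common integrable bound.\<close>
    define B where "B = ball (0::'a) (R + norm w)"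
    have qb: "\<bar>quot f v y t\<bar> \<le> L * norm v" for y t by (rule quot_Lipschitz_bound[OF f])
    have stepw: "norm (step n *\<^sub>R w) \<le> norm w" for n
      by (simp add: mult_left_le_one_le inverse_le_1_iff)
    have B: "y \<in> B" if "y \<in> ?Q \<or> y - step n *\<^sub>R w \<in> ?Q" for y n
    proof -
      have "norm y < R + norm w"
        using that
      proof
        assume "y \<in> ?Q" then have "norm y < R" using R by auto
        then show ?thesis using norm_ge_zero[of w] by linarith
      next
        assume "y - step n *\<^sub>R w \<in> ?Q" then have "norm (y - step n *\<^sub>R w) < R" using R by auto
        then show ?thesis using norm_triangle_sub[of y "step n *\<^sub>R w"] stepw[of n] by linarith
      qed
      then show ?thesis by (simp add: B_def)
    qed
    have wB: "integrable lborel (\<lambda>y. (L * norm v) * indicator B y :: real)"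
      unfolding B_def using emeasure_lborel_ball_finite
      by (intro integrable_mult_right integrable_real_indicator) simp_all
    have bd: "\<bar>d n y\<bar> \<le> (L * norm v) * indicator B y" for n y
    proof (cases "y \<in> B")
      case True
      have "\<bar>d n y\<bar> = \<bar>indicator ?Q (y - step n *\<^sub>R w) - indicator ?Q y :: real\<bar> * \<bar>quot f v y (step n)\<bar>"
        by (simp add: d_def abs_mult)
      also have "\<dots> \<le> 1 * (L * norm v)"
        using qb by (intro mult_mono) (auto simp: indicator_def)
      finally show ?thesis using True by simp
    next
      case False
      then have "y \<notin> ?Q" "y - step n *\<^sub>R w \<notin> ?Q" using B by blast+
      then show ?thesis using False by (simp add: d_def)
    qed
    have int_d: "(\<integral>x. indicator ?Q x * g n x \<partial>lborel) = (\<integral>y. d n y \<partial>lborel)" for n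
    proof -
      let ?t = "step n *\<^sub>R w"
      have m1: "integrable lborel (\<lambda>x. indicator ?Q x * quot f v x (step n))"
      proof (rule Bochner_Integration.integrable_bound)
        show "integrable lborel (\<lambda>x. (L * norm v) * indicator ?Q x :: real)"
          by (intro integrable_mult_right fin)
        show "AE x in lborel. norm (indicator ?Q x * quot f v x (step n)) \<le> norm ((L * norm v) * indicator ?Q x :: real)"
        proof (rule AE_I2)
          fix x show "norm (indicator ?Q x * quot f v x (step n)) \<le> norm ((L * norm v) * indicator ?Q x :: real)"
            using order_trans[OF qb[of x "step n"] abs_ge_self] by (cases "x \<in> ?Q") simp_all
        qed
      qed measurable
      have m2: "integrable lborel (\<lambda>y. indicator ?Q (y - ?t) * quot f v y (step n))"
      proof (rule Bochner_Integration.integrable_bound[OF wB])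
        show "AE y in lborel. norm (indicator ?Q (y - ?t) * quot f v y (step n)) \<le> norm ((L * norm v) * indicator B y :: real)"
        proof (rule AE_I2)
          fix y show "norm (indicator ?Q (y - ?t) * quot f v y (step n)) \<le> norm ((L * norm v) * indicator B y :: real)"
            using order_trans[OF qb[of y "step n"] abs_ge_self] B[of y n] by (cases "y - ?t \<in> ?Q") simp_all
        qed
      qed measurable
      have "(\<integral>y. indicator ?Q (y - ?t) * quot f v y (step n) \<partial>lborel) =
          (\<integral>y. indicator ?Q (y - ?t) * quot f v y (step n) \<partial>distr lborel borel ((+) ?t))"
        by (simp add: lborel_distr_plus)
      also have "\<dots> = (\<integral>x. indicator ?Q x * quot f v (x + ?t) (step n) \<partial>lborel)"
        by (subst integral_distr) (auto simp: add.commute)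
      finally have tr: "(\<integral>x. indicator ?Q x * quot f v (x + ?t) (step n) \<partial>lborel) =
          (\<integral>y. indicator ?Q (y - ?t) * quot f v y (step n) \<partial>lborel)" by simp
      have m3: "integrable lborel (\<lambda>x. indicator ?Q x * quot f v (x + ?t) (step n))"
        using Bochner_Integration.integrable_add[OF dc(3)[of a b n] m1] by (simp add: g_eq algebra_simps)
      have "(\<integral>x. indicator ?Q x * g n x \<partial>lborel) =
          (\<integral>x. indicator ?Q x * quot f v (x + ?t) (step n) \<partial>lborel) - (\<integral>x. indicator ?Q x * quot f v x (step n) \<partial>lborel)"
        using Bochner_Integration.integral_diff[OF m3 m1] by (simp add: g_eq algebra_simps)
      also have "\<dots> = (\<integral>y. indicator ?Q (y - ?t) * quot f v y (step n) - indicator ?Q y * quot f v y (step n) \<partial>lborel)"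
        unfolding tr by (rule Bochner_Integration.integral_diff[OF m2 m1, symmetric])
      finally show ?thesis by (simp add: d_def algebra_simps)
    qed
    \<comment> \<open>Off the boundary of the box, \<open>y\<close> and its small translates are
      eventually on the same side, and the indicators cancel exactly.\<close>
    have lim_d: "AE y in lborel. (\<lambda>n. d n y) \<longlonglongrightarrow> 0"
    proof -
      have "cbox a b - box a b \<in> null_sets lborel"
        using negligible_frontier_interval[of a b] by (intro null_setsI) (auto simp: negligible_iff_emeasure0)
      then have "AE y in lborel. y \<notin> cbox a b - box a b" by (rule AE_not_in)
      then show ?thesis
      proof eventually_elim
        case (elim y)
        have "(\<lambda>n. step n *\<^sub>R w) \<longlonglongrightarrow> 0 *\<^sub>R w" by (intro tendsto_scaleR LIMSEQ_inverse_real_of_nat tendsto_const)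
        then have conv: "(\<lambda>n. y - step n *\<^sub>R w) \<longlonglongrightarrow> y" by (auto intro: tendsto_eq_intros)
        have "\<forall>\<^sub>F n in sequentially. d n y = 0"
        proof (cases "y \<in> box a b")
          case True
          then have "\<forall>\<^sub>F n in sequentially. y - step n *\<^sub>R w \<in> box a b"
            using conv open_box by (rule topological_tendstoD[rotated 2])
          then show ?thesis using True by (auto elim!: eventually_mono simp: d_def)
        next
          case False
          then have "y \<in> - cbox a b" using elim by blast
          then have "\<forall>\<^sub>F n in sequentially. y - step n *\<^sub>R w \<in> - cbox a b"
            using conv by (intro topological_tendstoD) (auto simp: open_Compl)
          then show ?thesis
            by (rule eventually_mono) (use False box_subset_cbox[of a b] in \<open>auto simp: d_def indicator_def\<close>)
        qed
        then show ?case by (rule tendsto_eventually)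
      qed
    qed
    have "(\<lambda>n. \<integral>y. d n y \<partial>lborel) \<longlonglongrightarrow> lebesgue_integral lborel (\<lambda>y::'a. 0 :: real)"
    proof (rule integral_dominated_convergence[OF _ _ wB lim_d])
      show "d n \<in> borel_measurable lborel" for n unfolding d_def by measurable
    qed (use bd in auto)
    then show ?thesis
      using LIMSEQ_unique[OF dc(2)[of a b]] by (simp add: int_d)
  qed
  then have "AE x in lborel. h x = 0"
    by (intro AE_eq_0_if_integral_box_eq_0 hm dc(1))
  then show ?thesis by eventually_elim (simp add: h_def)
qed

lemma quot_scale_tendsto:
  assumes "(quot f v x \<longlongrightarrow> l) (at 0)"
  shows "(quot f (c *\<^sub>R v) x \<longlongrightarrow> c * l) (at 0)"
proof (cases "c = 0")
  case True
  then have "quot f (c *\<^sub>R v) x = (\<lambda>h. 0)" by (simp add: quot_def fun_eq_iff)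
  then show ?thesis using True by simp
next
  case False
  have "filterlim (\<lambda>h::real. c * h) (at 0) (at 0)"
    using False by (auto simp: filterlim_at eventually_at_filter intro!: tendsto_eq_intros)
  from filterlim_compose[OF assms this]
  have "((\<lambda>h. c * quot f v x (c * h)) \<longlongrightarrow> c * l) (at 0)" by (rule tendsto_mult_left)
  moreover have "c * quot f v x (c * h) = quot f (c *\<^sub>R v) x h" for h
    using False by (simp add: quot_def mult.commute)
  ultimately show ?thesis by simp
qed

lemma AE_dir_deriv_sum:
  fixes f :: "'a::euclidean_space \<Rightarrow> real"
  assumes f: "L-lipschitz_on UNIV f" and "finite F"
  shows "AE x in lborel. dir_deriv f (\<Sum>b\<in>F. c b *\<^sub>R b) x = (\<Sum>b\<in>F. c b * dir_deriv f b x)"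
  using \<open>finite F\<close>
proof induction
  case empty
  have "dir_deriv f 0 x = 0" for x
    by (rule dir_deriv_eqI) (simp add: quot_def[abs_def])
  then show ?case by simp
next
  case (insert b F)
  show ?case
    using insert.IH AE_dir_deriv_add[OF f, of "c b *\<^sub>R b" "\<Sum>b\<in>F. c b *\<^sub>R b"] AE_dir_deriv[OF f, of b]
  proof eventually_elim
    case (elim x)
    then show ?case
      using insert.hyps dir_deriv_eqI[OF quot_scale_tendsto[OF elim(3), of "c b"]] by simp
  qed
qed

text \<open>The exceptional null set depends on \<open>v\<close>, so the statement can be made
  simultaneous only for countably many directions; a countable dense set of them will do.\<close>

lemma AE_quot_tendsto_gradient:
  fixes f :: "'a::euclidean_space \<Rightarrow> real"
  assumes f: "L-lipschitz_on UNIV f"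
  shows "AE x in lborel. (quot f v x \<longlongrightarrow> (\<Sum>b\<in>Basis. dir_deriv f b x *\<^sub>R b) \<bullet> v) (at 0)"
  using AE_dir_deriv[OF f, of v] AE_dir_deriv_sum[OF f finite_Basis, of "\<lambda>b. v \<bullet> b"]
proof eventually_elim
  case (elim x)
  have "dir_deriv f v x = (\<Sum>b\<in>Basis. dir_deriv f b x *\<^sub>R b) \<bullet> v"
    using elim(2) by (simp add: euclidean_representation inner_sum_right inner_commute[of _ v] mult.commute)
  then show ?case using elim(1) by simp
qed

text \<open>By compactness, finitely many directions of \<open>D\<close> come within
  \<open>\<delta>\<close> of every unit vector, so the directional limits are uniform over them. The
  Lipschitz bound on \<open>f\<close> and Cauchy-Schwarz for \<open>G\<close> carry the estimate to
  all other directions.\<close>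

lemma has_derivative_if_dense_directional:
  fixes f :: "'a::euclidean_space \<Rightarrow> real"
  assumes f: "L-lipschitz_on UNIV f"
    and dense: "\<And>X. open X \<Longrightarrow> X \<noteq> {} \<Longrightarrow> \<exists>d\<in>D. d \<in> X"
    and lim: "\<And>v. v \<in> D \<Longrightarrow> (quot f v x \<longlongrightarrow> G \<bullet> v) (at 0)"
  shows "(f has_derivative (\<lambda>h. G \<bullet> h)) (at x)"
  unfolding has_derivative_at_alt
proof (intro conjI allI impI)
  show "bounded_linear (\<lambda>h. G \<bullet> h)" by (rule bounded_linear_inner_right)
  fix e :: real assume e: "e > 0"
  have L: "L \<ge> 0" by (rule lipschitz_on_nonneg[OF f])
  \<comment> \<open>Replacing a direction by a \<open>\<delta>\<close>-close one costs at most
    \<open>(L + norm G) * \<delta>\<close>, here at most \<open>e / 2\<close>; the summand 1 keeps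
    the denominator positive.\<close>
  define \<delta> where "\<delta> = e / (2 * (L + norm G + 1))"
  have pos: "L + norm G + 1 > 0" using L by (simp add: add_nonneg_pos)
  have \<delta>: "\<delta> > 0" using e pos by (simp add: \<delta>_def)
  have "(L + norm G + 1) * \<delta> = e / 2" using pos by (simp add: \<delta>_def field_simps)
  then have \<delta>e: "L * \<delta> + norm G * \<delta> \<le> e / 2" using \<delta> by (simp add: algebra_simps)
  have "sphere 0 1 \<subseteq> (\<Union>v\<in>D. ball v \<delta>)"
  proof
    fix \<theta> :: 'a
    obtain v where "v \<in> D" "v \<in> ball \<theta> \<delta>" using dense[of "ball \<theta> \<delta>"] \<delta> by auto
    then show "\<theta> \<in> (\<Union>v\<in>D. ball v \<delta>)" by (auto simp: dist_commute)
  qed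
  then obtain D' where D': "D' \<subseteq> D" "finite D'" "sphere 0 1 \<subseteq> (\<Union>v\<in>D'. ball v \<delta>)"
    using compactE_image[OF compact_sphere[of "0::'a" 1], of D "\<lambda>v. ball v \<delta>"] by auto
  have "\<forall>\<^sub>F h in at 0. \<forall>v\<in>D'. dist (quot f v x h) (G \<bullet> v) < e / 2"
    using D' lim e by (intro eventually_ball_finite ballI tendstoD) auto
  then obtain d where d: "d > 0" "\<And>h v. h \<noteq> 0 \<Longrightarrow> \<bar>h\<bar> < d \<Longrightarrow> v \<in> D' \<Longrightarrow> dist (quot f v x h) (G \<bullet> v) < e / 2"
    unfolding eventually_at by (auto simp: dist_norm)
  show "\<exists>d>0. \<forall>y. norm (y - x) < d \<longrightarrow> norm (f y - f x - G \<bullet> (y - x)) \<le> e * norm (y - x)"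
  proof (intro exI conjI allI impI)
    fix y assume y: "norm (y - x) < d"
    show "norm (f y - f x - G \<bullet> (y - x)) \<le> e * norm (y - x)"
    proof (cases "y = x")
      case False
      define t where "t = norm (y - x)"
      define \<theta> where "\<theta> = (1 / t) *\<^sub>R (y - x)"
      have t: "t > 0" using False by (simp add: t_def)
      have y_eq: "y = x + t *\<^sub>R \<theta>" using t by (simp add: \<theta>_def)
      have "norm \<theta> = 1" using t by (simp add: \<theta>_def t_def)
      then obtain v where v: "v \<in> D'" "norm (\<theta> - v) < \<delta>"
        using D'(3) by (force simp: dist_norm norm_minus_commute)
      have a: "\<bar>f (x + t *\<^sub>R \<theta>) - f (x + t *\<^sub>R v)\<bar> \<le> L * (t * norm (\<theta> - v))"
        using lipschitz_onD[OF f, of "x + t *\<^sub>R \<theta>" "x + t *\<^sub>R v"] t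
        by (simp add: dist_norm flip: scaleR_diff_right)
      have "\<bar>quot f v x t - G \<bullet> v\<bar> < e / 2"
        using d(2)[of t v] t y v(1) by (simp add: t_def dist_real_def)
      then have "\<bar>t * (quot f v x t - G \<bullet> v)\<bar> \<le> t * (e / 2)"
        using t by (simp add: abs_mult)
      moreover have tq: "t * quot f v x t = f (x + t *\<^sub>R v) - f x"
        using t by (simp add: quot_def)
      ultimately have b: "\<bar>f (x + t *\<^sub>R v) - f x - t * (G \<bullet> v)\<bar> \<le> t * (e / 2)"
        using tq by (simp add: right_diff_distrib)
      have c: "\<bar>t * (G \<bullet> v) - t * (G \<bullet> \<theta>)\<bar> \<le> t * (norm G * norm (\<theta> - v))"
        using Cauchy_Schwarz_ineq2[of G "v - \<theta>"] t
        by (simp add: abs_mult norm_minus_commute inner_diff_right flip: right_diff_distrib)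
      have "\<bar>f y - f x - G \<bullet> (y - x)\<bar> \<le> L * (t * norm (\<theta> - v)) + t * (e / 2) + t * (norm G * norm (\<theta> - v))"
      proof -
        have "f y - f x - G \<bullet> (y - x) = (f (x + t *\<^sub>R \<theta>) - f (x + t *\<^sub>R v)) +
            (f (x + t *\<^sub>R v) - f x - t * (G \<bullet> v)) + (t * (G \<bullet> v) - t * (G \<bullet> \<theta>))"
          by (simp add: y_eq)
        then show ?thesis using a b c by linarith
      qed
      also have "\<dots> = t * ((L + norm G) * norm (\<theta> - v) + e / 2)"
        by (simp add: algebra_simps)
      also have "\<dots> \<le> t * ((L + norm G) * \<delta> + e / 2)"
        using v(2) t L by (intro mult_left_mono add_right_mono) auto
      also have "\<dots> \<le> t * e"
        using \<delta>e t by (intro mult_left_mono) (auto simp: algebra_simps)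
      finally show ?thesis by (simp add: t_def mult.commute)
    qed simp
  qed (rule d(1))
qed

theorem Rademacher_real:
  fixes f :: "'a::euclidean_space \<Rightarrow> real"
  assumes f: "L-lipschitz_on UNIV f"
  shows "AE x in lborel. f differentiable (at x)"
proof -
  obtain D :: "'a set" where D: "countable D" "\<And>X. open X \<Longrightarrow> X \<noteq> {} \<Longrightarrow> \<exists>d\<in>D. d \<in> X"
    using countable_dense_setE by blast
  have "AE x in lborel. \<forall>v\<in>D. (quot f v x \<longlongrightarrow> (\<Sum>b\<in>Basis. dir_deriv f b x *\<^sub>R b) \<bullet> v) (at 0)"
    using AE_quot_tendsto_gradient[OF f] by (subst AE_ball_countable[OF D(1)]) auto
  then show ?thesis
  proof eventually_elim
    case (elim x)
    then show ?case
      using has_derivative_if_dense_directional[OF f D(2)] unfolding differentiable_def by blast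
  qed
qed

theorem Rademacher:
  fixes f :: "'a::euclidean_space \<Rightarrow> 'b::euclidean_space"
  assumes f: "L-lipschitz_on UNIV f"
  shows "negligible {x. \<not> f differentiable (at x)}"
proof -
  have "AE x in lborel. \<forall>b\<in>Basis. (\<lambda>x. f x \<bullet> b) differentiable (at x)"
  proof (subst AE_ball_countable[OF countable_finite[OF finite_Basis]], rule ballI, rule Rademacher_real)
    fix b :: 'b assume b: "b \<in> Basis"
    show "L-lipschitz_on UNIV (\<lambda>x. f x \<bullet> b)"
    proof (rule lipschitz_onI)
      fix x y
      have "dist (f x \<bullet> b) (f y \<bullet> b) \<le> dist (f x) (f y)"
        using Basis_le_norm[OF b, of "f x - f y"] by (simp add: dist_norm inner_diff_left)
      then show "dist (f x \<bullet> b) (f y \<bullet> b) \<le> L * dist x y"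
        using lipschitz_onD[OF f, of x y] by simp
    qed (rule lipschitz_on_nonneg[OF f])
  qed
  then have "AE x in lborel. f differentiable (at x)"
    by eventually_elim (subst differentiable_componentwise_within)
  then obtain N where "N \<in> null_sets lborel" "{x. \<not> f differentiable (at x)} \<subseteq> N"
    by (auto simp: eventually_ae_filter)
  then show ?thesis
    using negligible_iff_null_sets negligible_subset null_sets_completionI by blast
qed

text \<open>Composing with the nearest-point projection onto a smaller closed ball, which is
  1-Lipschitz, gives a globally Lipschitz function that agrees with \<open>f\<close> near the
  centre. Negligibility is then a local matter.\<close>

corollary Rademacher_local:
  fixes f :: "'a::euclidean_space \<Rightarrow> 'b::euclidean_space"
  assumes lip: "\<And>x. x \<in> S \<Longrightarrow> \<exists>r>0. \<exists>L. L-lipschitz_on (ball x r) f"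
  shows "negligible {x \<in> S. \<not> f differentiable (at x)}"
proof -
  let ?Z = "{x \<in> S. \<not> f differentiable (at x)}"
  have "\<exists>U. openin (top_of_set ?Z) U \<and> x \<in> U \<and> negligible U" if x: "x \<in> ?Z" for x
  proof -
    obtain r L where r: "r > 0" and L: "L-lipschitz_on (ball x r) f" using lip x by blast
    let ?B = "cball x (r / 2)"
    have B: "convex ?B" "closed ?B" "?B \<noteq> {}" "?B \<subseteq> ball x r" using r by auto
    define g where "g = (\<lambda>y. f (closest_point ?B y))"
    have "L-lipschitz_on UNIV g"
    proof (rule lipschitz_onI)
      fix y z
      have cp: "closest_point ?B w \<in> ball x r" for w
        using closest_point_in_set[OF B(2,3)] B(4) by blast
      have "dist (g y) (g z) \<le> L * dist (closest_point ?B y) (closest_point ?B z)"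
        unfolding g_def by (rule lipschitz_onD[OF L cp cp])
      also have "\<dots> \<le> L * dist y z"
        by (intro mult_left_mono closest_point_lipschitz B lipschitz_on_nonneg[OF L])
      finally show "dist (g y) (g z) \<le> L * dist y z" .
    qed (rule lipschitz_on_nonneg[OF L])
    then have "negligible {x. \<not> g differentiable (at x)}" by (rule Rademacher)
    moreover have "f differentiable (at y)" if y: "y \<in> ball x (r / 2)" and d: "g differentiable (at y)" for y
    proof -
      obtain g' where "(g has_derivative g') (at y)" using d by (auto simp: differentiable_def)
      then have "(f has_derivative g') (at y)"
        by (rule has_derivative_transform_within_open[OF _ open_ball y])
          (auto simp: g_def closest_point_self)
      then show ?thesis by (auto simp: differentiable_def)
    qed
    ultimately have "negligible (?Z \<inter> ball x (r / 2))"
      by (rule_tac negligible_subset) blast+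
    then show ?thesis using x r by (intro exI[where x="?Z \<inter> ball x (r / 2)"]) auto
  qed
  then show ?thesis using locally_negligible_alt by blast
qed

section \<open>Pointwise dilations\<close>

text \<open>The radius \<open>d\<close> may vary with the point, so bisection on the segment from
  \<open>a\<close> to \<open>b\<close> is used: the estimate is additive over adjacent parameter
  intervals and holds on short intervals around each parameter.\<close>

lemma lipschitz_on_if_pointwise_dilation:
  fixes u :: "'a::real_normed_vector \<Rightarrow> 'b::metric_space"
  assumes S: "convex S" and C: "C \<ge> 0"
    and loc: "\<And>x. x \<in> S \<Longrightarrow> \<exists>d>0. \<forall>y\<in>S. dist y x < d \<longrightarrow> dist (u y) (u x) \<le> C * dist y x"
  shows "C-lipschitz_on S u"
proof (rule lipschitz_onI)
  fix a b assume a: "a \<in> S" and b: "b \<in> S"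
  define \<gamma> where "\<gamma> = (\<lambda>t. a + t *\<^sub>R (b - a))"
  have \<gamma>S: "\<gamma> t \<in> S" if "0 \<le> t" "t \<le> 1" for t
    using convexD_alt[OF S a b that] by (simp add: \<gamma>_def algebra_simps)
  have d\<gamma>: "dist (\<gamma> s) (\<gamma> t) = \<bar>s - t\<bar> * dist a b" for s t
    by (simp add: \<gamma>_def dist_norm norm_minus_commute flip: scaleR_diff_left)
  have "0 \<le> (0::real) \<and> (1::real) \<le> 1 \<longrightarrow> dist (u (\<gamma> 0)) (u (\<gamma> 1)) \<le> C * ((1 - 0) * dist a b)"
  proof (rule Bolzano[where P="\<lambda>s t. 0 \<le> s \<and> t \<le> 1 \<longrightarrow> dist (u (\<gamma> s)) (u (\<gamma> t)) \<le> C * ((t - s) * dist a b)"])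
    fix p q r :: real
    assume pq: "0 \<le> p \<and> q \<le> 1 \<longrightarrow> dist (u (\<gamma> p)) (u (\<gamma> q)) \<le> C * ((q - p) * dist a b)"
      and qr: "0 \<le> q \<and> r \<le> 1 \<longrightarrow> dist (u (\<gamma> q)) (u (\<gamma> r)) \<le> C * ((r - q) * dist a b)"
      and o: "p \<le> q" "q \<le> r"
    show "0 \<le> p \<and> r \<le> 1 \<longrightarrow> dist (u (\<gamma> p)) (u (\<gamma> r)) \<le> C * ((r - p) * dist a b)"
    proof
      assume "0 \<le> p \<and> r \<le> 1"
      then show "dist (u (\<gamma> p)) (u (\<gamma> r)) \<le> C * ((r - p) * dist a b)"
        using pq qr o dist_triangle[of "u (\<gamma> p)" "u (\<gamma> r)" "u (\<gamma> q)"] by (simp add: algebra_simps)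
    qed
  next
    fix x :: real assume x: "0 \<le> x" "x \<le> 1"
    obtain d where d: "d > 0" "\<And>y. y \<in> S \<Longrightarrow> dist y (\<gamma> x) < d \<Longrightarrow> dist (u y) (u (\<gamma> x)) \<le> C * dist y (\<gamma> x)"
      using loc[OF \<gamma>S[OF x]] by blast
    \<comment> \<open>Parameter length is converted to distance; the summand 1 covers the case
      \<open>a = b\<close>.\<close>
    define e where "e = d / (dist a b + 1)"
    have ab: "dist a b + 1 > 0" by (simp add: add_nonneg_pos)
    have e: "e > 0" "e * dist a b < d" using d(1) ab by (simp_all add: e_def divide_simps)
    show "\<exists>d>0. \<forall>s t. s \<le> x \<and> x \<le> t \<and> t - s < d \<longrightarrow>
        0 \<le> s \<and> t \<le> 1 \<longrightarrow> dist (u (\<gamma> s)) (u (\<gamma> t)) \<le> C * ((t - s) * dist a b)"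
    proof (intro exI conjI allI impI)
      fix s t :: real assume st: "s \<le> x \<and> x \<le> t \<and> t - s < e" "0 \<le> s \<and> t \<le> 1"
      have near: "dist (u (\<gamma> r)) (u (\<gamma> x)) \<le> C * (\<bar>r - x\<bar> * dist a b)" if "r = s \<or> r = t" for r
      proof -
        have "\<bar>r - x\<bar> * dist a b \<le> e * dist a b"
          using that st by (intro mult_right_mono) auto
        then show ?thesis using d(2)[of "\<gamma> r"] \<gamma>S[of r] that st x e(2) by (auto simp: d\<gamma>)
      qed
      show "dist (u (\<gamma> s)) (u (\<gamma> t)) \<le> C * ((t - s) * dist a b)"
        using near[of s] near[of t] st dist_triangle2[of "u (\<gamma> s)" "u (\<gamma> t)" "u (\<gamma> x)"]
        by (simp add: algebra_simps)
    qed (rule e(1))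
  qed simp
  then show "dist (u a) (u b) \<le> C * dist a b" by (simp add: \<gamma>_def)
qed (rule C)

lemma upper_dil_imp_pointwise_dilation:
  assumes "upper_dil X u x \<le> ereal K" "K < C"
  shows "\<exists>d>0. \<forall>y\<in>X. dist y x < d \<longrightarrow> dist (u y) (u x) \<le> C * dist y x"
proof -
  have "Limsup (at x within X) (\<lambda>y. ereal (dist (u y) (u x) / dist y x)) < ereal C"
    using assms unfolding upper_dil_def by (metis less_ereal.simps(1) order_le_less_trans)
  then have "\<forall>\<^sub>F y in at x within X. ereal (dist (u y) (u x) / dist y x) < ereal C"
    by (rule Limsup_lessD)
  then obtain d where d: "d > 0"
      "\<And>y. y \<in> X \<Longrightarrow> y \<noteq> x \<Longrightarrow> dist y x < d \<Longrightarrow> dist (u y) (u x) / dist y x < C"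
    unfolding eventually_at by auto
  have "dist (u y) (u x) \<le> C * dist y x" if "y \<in> X" "dist y x < d" for y
    using d(2)[OF that(1) _ that(2)] by (cases "y = x") (auto simp: divide_simps)
  with d(1) show ?thesis by blast
qed

text \<open>The quotient is infinite at any other point with the same value, so a finite upper limit
  excludes such points near \<open>x\<close>.\<close>

lemma co_dil_imp_isolated:
  assumes "co_dil X u x \<le> ereal H"
  shows "\<exists>d>0. \<forall>y\<in>X. y \<noteq> x \<longrightarrow> dist y x < d \<longrightarrow> u y \<noteq> u x"
proof -
  have "Limsup (at x within X) (\<lambda>y. if u y = u x then \<infinity> else ereal (dist y x / dist (u y) (u x))) < \<infinity>"
    using assms unfolding co_dil_def by (metis ereal_infty_less(1) ereal_infty_less_eq(1) PInfty_neq_ereal(1) less_le)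
  then have "\<forall>\<^sub>F y in at x within X. (if u y = u x then \<infinity> else ereal (dist y x / dist (u y) (u x))) < \<infinity>"
    by (rule Limsup_lessD)
  then show ?thesis unfolding eventually_at by (auto split: if_splits)
qed

lemma countable_cball_basis:
  fixes \<Omega> :: "'a::euclidean_space set"
  assumes "open \<Omega>"
  obtains \<B> where "countable \<B>" "\<And>B. B \<in> \<B> \<Longrightarrow> compact B \<and> B \<subseteq> \<Omega>"
    "\<And>x d. x \<in> \<Omega> \<Longrightarrow> d > 0 \<Longrightarrow> \<exists>B\<in>\<B>. x \<in> B \<and> B \<subseteq> ball x d"
proof -
  obtain D :: "'a set" where D: "countable D" "\<And>X. open X \<Longrightarrow> X \<noteq> {} \<Longrightarrow> \<exists>d\<in>D. d \<in> X"
    using countable_dense_setE by blast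
  define \<B> where "\<B> = {B \<in> (\<lambda>(c, s). cball c s) ` (D \<times> (\<rat> :: real set)). B \<subseteq> \<Omega>}"
  show thesis
  proof (rule that)
    show "countable \<B>"
      unfolding \<B>_def using D(1) countable_rat by (intro countable_Collect countable_image countable_SIGMA)
    show "compact B \<and> B \<subseteq> \<Omega>" if "B \<in> \<B>" for B using that by (auto simp: \<B>_def)
    fix x and d :: real assume x: "x \<in> \<Omega>" and d: "d > 0"
    obtain e where e: "e > 0" "ball x e \<subseteq> \<Omega>" using assms x open_contains_ball by blast
    define m where "m = min d e / 2"
    have "0 < m" using d e by (simp add: m_def)
    then obtain s where s: "s \<in> \<rat>" "0 < s" "s < m" using Rats_dense_in_real by blast
    obtain c where c: "c \<in> D" "c \<in> ball x s" using D(2)[of "ball x s"] s by auto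
    have "cball c s \<subseteq> ball x (min d e)"
    proof
      fix y assume "y \<in> cball c s"
      then have "dist x y < m + m" using c(2) s(3) dist_triangle[of x y c] by (simp add: dist_commute)
      then show "y \<in> ball x (min d e)" by (simp add: m_def)
    qed
    moreover have "x \<in> cball c s" using c(2) by (simp add: dist_commute)
    moreover have "ball x (min d e) \<subseteq> ball x d" "ball x (min d e) \<subseteq> ball x e"
      by (simp_all add: subset_ball)
    ultimately have "x \<in> cball c s" "cball c s \<subseteq> ball x d" "cball c s \<subseteq> \<Omega>"
      using e(2) by blast+
    then show "\<exists>B\<in>\<B>. x \<in> B \<and> B \<subseteq> ball x d"
      using c(1) s(1) by (intro bexI[where x="cball c s"]) (auto simp: \<B>_def)
  qed
qed

section \<open>Injectivity\<close>

text \<open>The dilation bounds enter through two local consequences: \<open>loc_lip\<close> comes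
  from the upper dilation and \<open>isolated\<close> from the co-dilation.\<close>

locale incompressible_refo =
  fixes \<Omega> Y :: "(real^'n) set" and u :: "real^'n \<Rightarrow> real^'n"
  assumes open_\<Omega>: "open \<Omega>" and open_Y: "open Y"
    and maps: "u ` \<Omega> \<subseteq> Y"
    and preserving: "A \<in> sets borel \<Longrightarrow> emeasure lebesgue (\<Omega> \<inter> u -` A) = emeasure lebesgue (Y \<inter> A)"
    and loc_lip: "x \<in> \<Omega> \<Longrightarrow> \<exists>r>0. \<exists>L. L-lipschitz_on (ball x r) u"
    and isolated: "x \<in> \<Omega> \<Longrightarrow> \<exists>d>0. \<forall>y\<in>\<Omega>. y \<noteq> x \<longrightarrow> dist y x < d \<longrightarrow> u y \<noteq> u x"
    and unit_Jacobian: "negligible {x \<in> \<Omega>. \<not> (\<exists>L. (u has_derivative L) (at x) \<and> \<bar>det (matrix L)\<bar> = 1)}"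
begin

lemma continuous: "continuous_on \<Omega> u"
proof (rule continuous_at_imp_continuous_on, rule ballI)
  fix x assume "x \<in> \<Omega>"
  then obtain r L where "r > 0" "L-lipschitz_on (ball x r) u" using loc_lip by blast
  then show "isCont u x"
    using lipschitz_on_continuous_on continuous_on_interior[of "ball x r" u x] by auto
qed

lemma open_preimage: "open V \<Longrightarrow> open (\<Omega> \<inter> u -` V)"
  using continuous_open_preimage[OF continuous open_\<Omega>] by simp

lemma locally_Lipschitz_norm:
  assumes "S \<subseteq> \<Omega>" "x \<in> S"
  shows "\<exists>T B. open T \<and> x \<in> T \<and> (\<forall>y\<in>S \<inter> T. norm (u y - u x) \<le> B * norm (y - x))"
proof -
  obtain r L where "r > 0" "L-lipschitz_on (ball x r) u" using loc_lip assms by blast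
  then have "\<forall>y\<in>S \<inter> ball x r. norm (u y - u x) \<le> L * norm (y - x)"
    using lipschitz_onD[of L "ball x r" u _ x] by (auto simp: dist_norm)
  then show ?thesis using \<open>r > 0\<close> by (intro exI[where x="ball x r"] exI[where x=L]) simp
qed

lemma measure_image_le:
  assumes "compact S" "S \<subseteq> \<Omega>"
  shows "measure lebesgue (u ` S) \<le> measure lebesgue S"
proof (rule measure_unit_Jacobian_image[OF assms(1) continuous_on_subset[OF continuous assms(2)]])
  show "negligible {x \<in> S. \<not> (\<exists>L. (u has_derivative L) (at x) \<and> \<bar>det (matrix L)\<bar> = 1)}"
    by (rule negligible_subset[OF unit_Jacobian]) (use assms(2) in blast)
qed (rule locally_Lipschitz_norm[OF assms(2)])

text \<open>The part of \<open>\<Omega>\<close> over a doubly covered set \<open>E\<close> has measure \<open>\<bar>E\<bar>\<close> because \<open>u\<close> is measure preserving, and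
  at least \<open>2 * \<bar>E\<bar>\<close> because \<open>u\<close> does not increase measure.\<close>

lemma negligible_common_image:
  assumes C: "compact C1" "compact C2" "C1 \<subseteq> \<Omega>" "C2 \<subseteq> \<Omega>" "C1 \<inter> C2 = {}"
  shows "negligible (u ` C1 \<inter> u ` C2)"
proof -
  define E where "E = u ` C1 \<inter> u ` C2"
  have cont: "continuous_on C1 u" "continuous_on C2 u"
    using C continuous continuous_on_subset by blast+
  have E: "compact E" "closed E"
    using cont C by (auto simp: E_def intro!: compact_Int compact_continuous_image compact_imp_closed)
  \<comment> \<open>Cutting both sets down to the points over \<open>E\<close> makes each of them
    map onto \<open>E\<close>, so each has at least the measure of \<open>E\<close>.\<close>
  define S1 S2 where "S1 = C1 \<inter> u -` E" and "S2 = C2 \<inter> u -` E"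
  have "closed S1" "closed S2"
    unfolding S1_def S2_def
    by (intro continuous_closed_preimage cont compact_imp_closed[OF C(1)] compact_imp_closed[OF C(2)] E(2))+
  then have "compact (C1 \<inter> S1)" "compact (C2 \<inter> S2)"
    using C(1,2) by (auto intro: compact_Int_closed)
  then have S: "compact S1" "compact S2"
    by (simp_all add: S1_def S2_def flip: Int_assoc)
  have "E \<subseteq> u ` C1" "E \<subseteq> u ` C2" by (simp_all add: E_def)
  then have im: "u ` S1 = E" "u ` S2 = E" unfolding S1_def S2_def by blast+
  have sub: "S1 \<subseteq> \<Omega>" "S2 \<subseteq> \<Omega>" "S1 \<inter> S2 = {}" using C by (auto simp: S1_def S2_def)
  have lm: "S1 \<in> lmeasurable" "S2 \<in> lmeasurable" "E \<in> lmeasurable"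
    using S E by (auto intro: lmeasurable_compact)
  have "\<Omega> \<inter> u -` E = \<Omega> - (\<Omega> \<inter> u -` (- E))" by auto
  then have P: "\<Omega> \<inter> u -` E \<in> sets lebesgue"
    using open_preimage[OF open_Compl[OF E(2)]] open_\<Omega> by (auto simp: borel_open intro!: sets.Diff)
  have "Y \<inter> E = E" using maps C by (auto simp: E_def)
  then have eq: "emeasure lebesgue (\<Omega> \<inter> u -` E) = emeasure lebesgue E"
    using preserving[of E] E by (simp add: borel_closed)
  then have PL: "\<Omega> \<inter> u -` E \<in> lmeasurable"
    using P fmeasurableD2[OF lm(3)] by (intro fmeasurableI) (simp_all only: eq less_top infinity_ennreal_def)
  have "measure lebesgue S1 + measure lebesgue S2 = measure lebesgue (S1 \<union> S2)"
    using measure_Un3[OF lm(1,2)] sub(3) by simp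
  also have "\<dots> \<le> measure lebesgue (\<Omega> \<inter> u -` E)"
    using lm sub PL by (intro measure_mono_fmeasurable) (auto simp: S1_def S2_def)
  also have "\<dots> = measure lebesgue E" using eq by (simp add: measure_def)
  finally have "measure lebesgue E = 0"
    using measure_image_le[OF S(1) sub(1)] measure_image_le[OF S(2) sub(2)]
      measure_nonneg[of lebesgue E] unfolding im by linarith
  then show ?thesis using lm(3) by (simp add: E_def negligible_iff_measure)
qed

text \<open>Two distinct points lie in disjoint members of one countable family of compact sets, so
  all doubly covered values are caught by countably many common images.\<close>

lemma negligible_multiple_values: "negligible {q. \<exists>x\<in>\<Omega>. \<exists>y\<in>\<Omega>. x \<noteq> y \<and> u x = q \<and> u y = q}"
proof -
  obtain \<B> where \<B>: "countable \<B>" "\<And>B. B \<in> \<B> \<Longrightarrow> compact B \<and> B \<subseteq> \<Omega>"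
    "\<And>x d. x \<in> \<Omega> \<Longrightarrow> d > 0 \<Longrightarrow> \<exists>B\<in>\<B>. x \<in> B \<and> B \<subseteq> ball x d"
    using countable_cball_basis[OF open_\<Omega>] by blast
  define I where "I = {(P, Q) \<in> \<B> \<times> \<B>. P \<inter> Q = {}}"
  have cI: "countable I"
    by (rule countable_subset[of _ "\<B> \<times> \<B>"]) (auto simp: I_def \<B>(1))
  have "negligible (\<Union>z\<in>I. u ` fst z \<inter> u ` snd z)"
    unfolding negligible_iff_null_sets
  proof (rule null_sets_UN'[OF cI])
    fix z assume "z \<in> I"
    then have "fst z \<in> \<B>" "snd z \<in> \<B>" "fst z \<inter> snd z = {}" by (auto simp: I_def)
    then show "u ` fst z \<inter> u ` snd z \<in> null_sets lebesgue"
      unfolding negligible_iff_null_sets[symmetric] using \<B>(2)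
      by (intro negligible_common_image) blast+
  qed
  moreover have "{q. \<exists>x\<in>\<Omega>. \<exists>y\<in>\<Omega>. x \<noteq> y \<and> u x = q \<and> u y = q} \<subseteq> (\<Union>z\<in>I. u ` fst z \<inter> u ` snd z)"
  proof clarify
    fix x y assume xy: "x \<in> \<Omega>" "y \<in> \<Omega>" "x \<noteq> y" "u y = u x"
    define d where "d = dist x y / 2"
    have d: "d > 0" using xy by (simp add: d_def)
    obtain P Q where PQ: "P \<in> \<B>" "x \<in> P" "P \<subseteq> ball x d" "Q \<in> \<B>" "y \<in> Q" "Q \<subseteq> ball y d"
      using \<B>(3)[OF xy(1) d] \<B>(3)[OF xy(2) d] by blast
    have "ball x d \<inter> ball y d = {}" by (rule disjoint_ballI) (simp add: d_def)
    then have "(P, Q) \<in> I" using PQ by (auto simp: I_def)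
    then show "u x \<in> (\<Union>z\<in>I. u ` fst z \<inter> u ` snd z)"
      using PQ xy(4) by (intro UN_I[of "(P, Q)"]) (auto intro: rev_image_eqI)
  qed
  ultimately show ?thesis by (rule negligible_subset)
qed

text \<open>The prescribed bound \<open>\<delta>\<close> on the radius allows the result to be
  applied in disjoint balls about two points of one fibre.\<close>

lemma image_cball_contains_ball:
  assumes x0: "x0 \<in> \<Omega>" and \<delta>: "\<delta> > 0"
  shows "\<exists>r>0. r \<le> \<delta> \<and> cball x0 r \<subseteq> \<Omega> \<and> (\<exists>\<epsilon>>0. ball (u x0) \<epsilon> \<subseteq> u ` cball x0 r)"
proof -
  obtain d where d: "d > 0" "\<And>y. y \<in> \<Omega> \<Longrightarrow> y \<noteq> x0 \<Longrightarrow> dist y x0 < d \<Longrightarrow> u y \<noteq> u x0"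
    using isolated[OF x0] by blast
  obtain e where e: "e > 0" "cball x0 e \<subseteq> \<Omega>" using open_\<Omega> x0 open_contains_cball by blast
  \<comment> \<open>With \<open>d / 2\<close> the whole sphere lies within the radius that isolates
    \<open>x0\<close> in its fibre; \<open>e\<close> keeps the ball in
    \<open>\<Omega>\<close>.\<close>
  define r where "r = min \<delta> (min e (d / 2))"
  have r: "r > 0" "r \<le> \<delta>" "r < d" using \<delta> d e by (auto simp: r_def)
  have sub: "cball x0 r \<subseteq> \<Omega>" using e(2) subset_cball[of r e x0] by (auto simp: r_def)
  have cont: "continuous_on (cball x0 r) u" by (rule continuous_on_subset[OF continuous sub])
  have "u x0 \<notin> u ` sphere x0 r"
  proof
    assume "u x0 \<in> u ` sphere x0 r"
    then obtain y where "u y = u x0" "dist x0 y = r" by auto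
    then show False using d(2)[of y] sub r by (auto simp: dist_commute)
  qed
  moreover have "compact (u ` sphere x0 r)"
    using cont continuous_on_subset[of "cball x0 r" u "sphere x0 r"] by (intro compact_continuous_image) auto
  ultimately have "open (Y - u ` sphere x0 r)" "u x0 \<in> Y - u ` sphere x0 r"
    using open_Y maps x0 by (auto intro: open_Diff compact_imp_closed)
  \<comment> \<open>Keeping the ball of values inside \<open>Y\<close> as well gives
    \<open>Y \<inter> F = F\<close> below, so that \<open>F\<close> and its preimage have equal
    measure.\<close>
  then obtain \<epsilon> where \<epsilon>: "\<epsilon> > 0" "ball (u x0) \<epsilon> \<subseteq> Y - u ` sphere x0 r"
    using open_contains_ball by blast
  define V where "V = ball (u x0) \<epsilon>"
  have "p \<in> u ` cball x0 r" if p: "p \<in> V" for p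
  proof (rule ccontr)
    assume np: "p \<notin> u ` cball x0 r"
    define Bad where "Bad = {x \<in> \<Omega>. \<not> (\<exists>L. (u has_derivative L) (at x) \<and> \<bar>det (matrix L)\<bar> = 1)}"
    define M where "M = {q. \<exists>x\<in>\<Omega>. \<exists>y\<in>\<Omega>. x \<noteq> y \<and> u x = q \<and> u y = q}"
    define F where "F = u ` cball x0 r \<inter> V"
    \<comment> \<open>A value of \<open>F\<close> outside both sets would have a single preimage in
      the ball, with invertible derivative there, and would force \<open>p\<close> to be
      attained.\<close>
    have "F \<subseteq> M \<union> u ` Bad"
    proof
      fix q assume q: "q \<in> F"
      then obtain x1 where x1: "x1 \<in> cball x0 r" "u x1 = q" by (auto simp: F_def)
      show "q \<in> M \<union> u ` Bad"
      proof (rule ccontr)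
        assume nq: "q \<notin> M \<union> u ` Bad"
        have "x1 \<in> \<Omega>" using x1 sub by blast
        then have "\<exists>L. (u has_derivative L) (at x1) \<and> \<bar>det (matrix L)\<bar> = 1"
          using nq x1(2) by (auto simp: Bad_def)
        then obtain L where L: "(u has_derivative L) (at x1)" "\<bar>det (matrix L)\<bar> = 1" by blast
        have "inj L" using det_nz_iff_inj[of L] L has_derivative_linear[OF L(1)] by auto
        moreover have "x = x1" if "x \<in> cball x0 r" "u x = q" for x
          using nq that x1 subsetD[OF sub that(1)] subsetD[OF sub x1(1)] by (auto simp: M_def)
        moreover have "u x \<notin> V" if "x \<in> sphere x0 r" for x
          using \<epsilon>(2) that by (auto simp: V_def)
        moreover have "convex V" "q \<in> V" using q by (auto simp: V_def F_def)
        ultimately have "p \<in> u ` cball x0 r"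
          using image_cball_if_unique_regular_preimage[OF cont, of V p q x1 L] p x1 L(1) by blast
        with np show False ..
      qed
    qed
    moreover have "negligible (u ` Bad)"
      using unit_Jacobian locally_Lipschitz_norm[of Bad] unfolding Bad_def
      by (intro negligible_locally_Lipschitz_image) auto
    ultimately have "negligible F"
      using negligible_multiple_values negligible_Un negligible_subset unfolding M_def by blast
    have K: "compact (u ` cball x0 r)" by (rule compact_continuous_image[OF cont compact_cball])
    have V: "open V" by (simp add: V_def)
    have F: "F \<in> sets borel" unfolding F_def using K V by (intro sets.Int borel_compact borel_open)
    have "Y \<inter> F = F" using \<epsilon>(2) by (auto simp: F_def V_def)
    then have "emeasure lebesgue (\<Omega> \<inter> u -` F) = 0"
      using preserving[OF F] \<open>negligible F\<close> F by (simp add: negligible_iff_emeasure0)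
    moreover have "\<Omega> \<inter> u -` F = (\<Omega> \<inter> u -` V) - (\<Omega> \<inter> u -` (- (u ` cball x0 r)))"
      by (auto simp: F_def)
    then have "\<Omega> \<inter> u -` F \<in> sets lebesgue"
      using open_preimage[OF V] open_preimage[OF open_Compl[OF compact_imp_closed[OF K]]]
      by (auto simp: borel_open intro!: sets.Diff)
    ultimately have "negligible (\<Omega> \<inter> u -` F)" by (simp add: negligible_iff_emeasure0)
    \<comment> \<open>The null preimage of \<open>F\<close> contains an open neighbourhood of
      \<open>x0\<close>, which is impossible.\<close>
    moreover have "ball x0 r \<inter> (\<Omega> \<inter> u -` V) \<subseteq> \<Omega> \<inter> u -` F"
      by (auto simp: F_def)
    ultimately have "negligible (ball x0 r \<inter> (\<Omega> \<inter> u -` V))" by (rule negligible_subset)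
    moreover have "open (ball x0 r \<inter> (\<Omega> \<inter> u -` V))" using open_preimage[OF V] by auto
    moreover have "x0 \<in> ball x0 r \<inter> (\<Omega> \<inter> u -` V)" using x0 r \<epsilon>(1) by (simp add: V_def)
    ultimately show False using open_not_negligible by blast
  qed
  then show ?thesis using r sub \<epsilon>(1) unfolding V_def by blast
qed

lemma injective: "inj_on u \<Omega>"
proof (rule inj_onI, rule ccontr)
  fix x y assume x: "x \<in> \<Omega>" and y: "y \<in> \<Omega>" and eq: "u x = u y" and ne: "x \<noteq> y"
  \<comment> \<open>A third of the distance makes the two closed balls disjoint even when both radii
    equal \<open>\<delta>\<close>.\<close>
  define \<delta> where "\<delta> = dist x y / 3"
  have \<delta>: "\<delta> > 0" using ne by (simp add: \<delta>_def)
  obtain r \<epsilon> where r: "r \<le> \<delta>" "cball x r \<subseteq> \<Omega>" and \<epsilon>: "\<epsilon> > 0" "ball (u x) \<epsilon> \<subseteq> u ` cball x r"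
    using image_cball_contains_ball[OF x \<delta>] by blast
  obtain r' \<epsilon>' where r': "r' \<le> \<delta>" "cball y r' \<subseteq> \<Omega>" and \<epsilon>': "\<epsilon>' > 0" "ball (u y) \<epsilon>' \<subseteq> u ` cball y r'"
    using image_cball_contains_ball[OF y \<delta>] by blast
  have disj: "a \<noteq> b" if "a \<in> cball x r" "b \<in> cball y r'" for a b
  proof
    assume "a = b"
    then have "dist x y \<le> r + r'" using that dist_triangle[of x y a] by (simp add: dist_commute)
    then show False using r(1) r'(1) \<delta> unfolding \<delta>_def by linarith
  qed
  have "ball (u x) (min \<epsilon> \<epsilon>') \<subseteq> {q. \<exists>x\<in>\<Omega>. \<exists>y\<in>\<Omega>. x \<noteq> y \<and> u x = q \<and> u y = q}"
  proof
    fix q assume "q \<in> ball (u x) (min \<epsilon> \<epsilon>')"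
    then have "q \<in> u ` cball x r" "q \<in> u ` cball y r'" using \<epsilon>(2) \<epsilon>'(2) eq by auto
    then obtain a b where "a \<in> cball x r" "b \<in> cball y r'" "u a = q" "u b = q" by auto
    then show "q \<in> {q. \<exists>x\<in>\<Omega>. \<exists>y\<in>\<Omega>. x \<noteq> y \<and> u x = q \<and> u y = q}"
      using disj r(2) r'(2) by blast
  qed
  then have "negligible (ball (u x) (min \<epsilon> \<epsilon>'))"
    using negligible_multiple_values negligible_subset by blast
  moreover have "u x \<in> ball (u x) (min \<epsilon> \<epsilon>')" using \<epsilon>(1) \<epsilon>'(1) by simp
  ultimately show False using open_not_negligible[OF open_ball] by blast
qed

end

theorem theorem2p13:
  fixes \<Omega> Y :: "(real^'n) set" and \<A> :: "(real^'n) set set"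
    and H K :: "real^'n \<Rightarrow> real" and u :: "real^'n \<Rightarrow> real^'n"
  assumes "\<Omega> \<noteq> {}" "open \<Omega>" "bounded \<Omega>" "connected \<Omega>" "emeasure lebesgue \<Omega> = 1"
    and "open Y" "emeasure lebesgue Y = 1"
    and "\<forall>x \<in> closure \<Omega>. H x > 0 \<and> K x > 0"
    and "set_integrable lebesgue \<Omega> H" "set_integrable lebesgue \<Omega> K"
    and "\<forall>B \<in> \<A>. \<exists>c r. r > 0 \<and> B = ball c r"
    and "closure \<Omega> \<subseteq> \<Union>\<A>"
    and "u \<in> Refo \<Omega> Y \<A> H K"
    and "AE x in lebesgue. x \<in> \<Omega> \<longrightarrow> u differentiable (at x) \<longrightarrow>
           \<bar>det (matrix (frechet_derivative u (at x)))\<bar> = 1"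
  shows "inj_on u \<Omega>"
proof -
  have \<Omega>c: "\<Omega> \<subseteq> closure \<Omega>" by (rule closure_subset)
  have refo: "u ` closure \<Omega> \<subseteq> Y"
      "\<And>A. A \<in> sets borel \<Longrightarrow> emeasure lebesgue (\<Omega> \<inter> u -` A) = emeasure lebesgue (Y \<inter> A)"
      "\<And>x. x \<in> closure \<Omega> \<Longrightarrow> \<exists>r>0. ball x r \<in> \<A> \<and>
         (\<forall>y \<in> cball x r \<inter> \<Omega>. co_dil (closure \<Omega>) u y \<le> ereal (H x) \<and>
                                 upper_dil (closure \<Omega>) u y \<le> ereal (K x))"
    using assms(13) unfolding Refo_def by blast+
  have lip: "\<exists>r>0. \<exists>L. L-lipschitz_on (ball x r) u" if x: "x \<in> \<Omega>" for x
  proof -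
    obtain r where r: "r > 0" "\<And>y. y \<in> cball x r \<inter> \<Omega> \<Longrightarrow> upper_dil (closure \<Omega>) u y \<le> ereal (K x)"
      using refo(3)[of x] x \<Omega>c by blast
    obtain e where e: "e > 0" "ball x e \<subseteq> \<Omega>" using assms(2) x open_contains_ball by blast
    define s where "s = min r e"
    have s: "s > 0" "ball x s \<subseteq> cball x r \<inter> \<Omega>"
      using r(1) e subset_ball[of s e x] ball_subset_cball[of x r] subset_ball[of s r x] by (auto simp: s_def)
    \<comment> \<open>The bound \<open>K x\<close> at the centre governs all points of the ball at
      once. A strictly larger constant is taken because an upper limit equal to \<open>K x\<close>
      still permits quotients slightly above it.\<close>
    have "(K x + 1)-lipschitz_on (ball x s) u"
    proof (rule lipschitz_on_if_pointwise_dilation)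
      show "0 \<le> K x + 1" using assms(8) x \<Omega>c by (smt (verit) subsetD)
      fix y assume "y \<in> ball x s"
      then have "upper_dil (closure \<Omega>) u y \<le> ereal (K x)" using r(2) s(2) by blast
      from upper_dil_imp_pointwise_dilation[OF this, of "K x + 1"]
      show "\<exists>d>0. \<forall>z\<in>ball x s. dist z y < d \<longrightarrow> dist (u z) (u y) \<le> (K x + 1) * dist z y"
        using s(2) \<Omega>c by (meson IntD2 less_add_one subsetD)
    qed simp
    with s(1) show ?thesis by blast
  qed
  \<comment> \<open>The Jacobian hypothesis is informative only at points of differentiability;
    Rademacher's theorem makes the remaining points of \<open>\<Omega>\<close> negligible.\<close>
  have "negligible {x \<in> \<Omega>. \<not> u differentiable (at x)}"
    using lip by (rule Rademacher_local)
  moreover obtain N where N: "N \<in> null_sets lebesgue"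
      "{x. \<not> (x \<in> \<Omega> \<longrightarrow> u differentiable (at x) \<longrightarrow> \<bar>det (matrix (frechet_derivative u (at x)))\<bar> = 1)} \<subseteq> N"
    using assms(14) unfolding eventually_ae_filter by auto
  ultimately have "negligible ({x \<in> \<Omega>. \<not> u differentiable (at x)} \<union> N)"
    by (simp add: negligible_iff_null_sets[symmetric])
  then have J: "negligible {x \<in> \<Omega>. \<not> (\<exists>L. (u has_derivative L) (at x) \<and> \<bar>det (matrix L)\<bar> = 1)}"
    by (rule negligible_subset) (use N(2) frechet_derivative_works in blast)
  have "\<exists>d>0. \<forall>y\<in>\<Omega>. y \<noteq> x \<longrightarrow> dist y x < d \<longrightarrow> u y \<noteq> u x" if x: "x \<in> \<Omega>" for x
  proof -
    have "co_dil (closure \<Omega>) u x \<le> ereal (H x)"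
      using refo(3)[of x] x \<Omega>c by (meson IntI centre_in_cball less_imp_le subsetD)
    then show ?thesis using co_dil_imp_isolated \<Omega>c by blast
  qed
  then interpret incompressible_refo \<Omega> Y u
    using assms(2,6) refo(1,2) lip J \<Omega>c by unfold_locales blast+
  show ?thesis by (rule injective)
qed

end
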